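(* Let $K$ be a field and let $\phi:(\mathcal{H}_{\mathcal{WNP}},\rightsquigarrow,\natural)\longrightarrow(\mathcal{H}_{\mathcal{WNP}},\star,\rightsquigarrow)$ be the unique morphism of $2$-$As$ algebras over $K$ sending $\bullet$ to $\bullet$. Then $\phi$ is bijective. As a consequence, $(\mathcal{H}_{\mathcal{WNP}},\star,\rightsquigarrow)$ is freely generated, as a $2$-$As$ algebra, by $\bullet$.
   Context: A double poset is a triple $(P,\leq_1,\leq_2)$ where $P$ is a finite set and $\leq_1,\leq_2$ are two partial orders on $P$; double posets are considered up to isomorphism, the empty one is denoted $1$ and the one-element one $\bullet$. A plane poset is a double poset $(P,\leq_h,\leq_r)$ (with $\leq_h=\leq_1$, $\leq_r=\leq_2$) such that for all $x\neq y$ in $P$, $x$ and $y$ are comparable for $\leq_h$ if and only if they are not comparable for $\leq_r$. Let $N_1$ and $N_2$ be the following plane posets on $\{a,b,c,d\}$ (listing all strict relations): $N_1$: $a<_h c$, $a<_h d$, $b<_h d$; $a<_r b$, $c<_r b$, $c<_r d$. $N_2$: $a<_h c$, $b<_h c$, $b<_h d$; $a<_r b$, $a<_r d$, $c<_r d$. A double poset is WN if it is plane and has no subposet (subset with restricted orders) isomorphic to $N_1$ or $N_2$. $\mathcal{WNP}$ is the set of isomorphism classes of WN posets and $\mathcal{H}_{\mathcal{WNP}}$ the $K$-vector space with basis $\mathcal{WNP}$. Products on $\mathcal{H}_{\mathcal{WNP}}$ (bilinear, associative, with unit $1$), for $P,Q\in\mathcal{WNP}$: $P\rightsquigarrow Q$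 is the disjoint union with $P,Q$ as double subposets and, for all $x\in P$, $y\in Q$, $x\leq_r y$ and $x,y$ not $\leq_h$-comparable; $P\natural Q$ is the disjoint union with $P,Q$ as double subposets and, for all $x\in P$, $y\in Q$, $x\leq_h y$ and $x,y$ not $\leq_r$-comparable; and $$P\star Q=\sum_{R\in\mathcal{WNP}}n(P,Q;R)\,R,$$ where $n(P,Q;R)$ is the number of ideals $I$ of $R$ (subsets such that $x\in I$, $y\in R$, $x\leq_h y$ imply $y\in I$) with $R\setminus I$ isomorphic to $P$ and $I$ isomorphic to $Q$. A $2$-$As$ algebra $(A,\cdot,* )$ is a $K$-vector space with two associative products sharing the same unit; morphisms $(A,\cdot,* )\to(A',\cdot',*')$ are unital linear maps sending $\cdot$ to $\cdot'$ and $*$ to $*'$. The $2$-$As$ algebra $(\mathcal{H}_{\mathcal{WNP}},\rightsquigarrow,\natural)$ is freely generated by $\bullet$, so $\phi$ is well defined. *)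

theory Defs
  imports Complex_Main "HOL-Library.Poly_Mapping" "HOL-Library.Nat_Bijection"
begin

section \<open>Double posets\<close>

datatype 'a dposet = DPoset (elems: "'a set") (le_h: "'a rel") (le_r: "'a rel")

definition double_poset :: "'a dposet \<Rightarrow> bool" where
  "double_poset P \<longleftrightarrow> finite (elems P)
     \<and> partial_order_on (elems P) (le_h P) \<and> partial_order_on (elems P) (le_r P)"

definition comparable :: "'a rel \<Rightarrow> 'a \<Rightarrow> 'a \<Rightarrow> bool" where
  "comparable r x y \<longleftrightarrow> (x, y) \<in> r \<or> (y, x) \<in> r"

definition plane_poset :: "'a dposet \<Rightarrow> bool" where
  "plane_poset P \<longleftrightarrow> double_poset P
     \<and> (\<forall>x\<in>elems P. \<forall>y\<in>elems P. x \<noteq> y \<longrightarrow>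
          (comparable (le_h P) x y \<longleftrightarrow> \<not> comparable (le_r P) x y))"

definition same_orders :: "('a \<Rightarrow> 'b) \<Rightarrow> 'a dposet \<Rightarrow> 'b dposet \<Rightarrow> bool" where
  "same_orders f P Q \<longleftrightarrow> (\<forall>x\<in>elems P. \<forall>y\<in>elems P.
     ((x, y) \<in> le_h P \<longleftrightarrow> (f x, f y) \<in> le_h Q) \<and> ((x, y) \<in> le_r P \<longleftrightarrow> (f x, f y) \<in> le_r Q))"

definition dp_iso :: "'a dposet \<Rightarrow> 'b dposet \<Rightarrow> bool" where
  "dp_iso P Q \<longleftrightarrow> (\<exists>f. bij_betw f (elems P) (elems Q) \<and> same_orders f P Q)"

text \<open>Only meaningful for \<open>S \<subseteq> elems P\<close>.\<close>

definition subposet :: "'a dposet \<Rightarrow> 'a set \<Rightarrow> 'a dposet" where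
  "subposet P S = DPoset S (le_h P \<inter> S \<times> S) (le_r P \<inter> S \<times> S)"

text \<open>The letters \<open>a\<close>, \<open>b\<close>, \<open>c\<close>, \<open>d\<close> are \<open>0\<close>, \<open>1\<close>, \<open>2\<close>, \<open>3\<close>.\<close>

definition N1 :: "nat dposet" where
  "N1 = DPoset {0, 1, 2, 3}
     (Id_on {0, 1, 2, 3} \<union> {(0, 2), (0, 3), (1, 3)})
     (Id_on {0, 1, 2, 3} \<union> {(0, 1), (2, 1), (2, 3)})"

definition N2 :: "nat dposet" where
  "N2 = DPoset {0, 1, 2, 3}
     (Id_on {0, 1, 2, 3} \<union> {(0, 2), (1, 2), (1, 3)})
     (Id_on {0, 1, 2, 3} \<union> {(0, 1), (0, 3), (2, 3)})"

definition WN :: "'a dposet \<Rightarrow> bool" where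
  "WN P \<longleftrightarrow> plane_poset P
     \<and> \<not> (\<exists>S\<subseteq>elems P. dp_iso (subposet P S) N1 \<or> dp_iso (subposet P S) N2)"

definition r_sum :: "'a dposet \<Rightarrow> 'b dposet \<Rightarrow> ('a + 'b) dposet" where
  "r_sum P Q = DPoset (elems P <+> elems Q)
     (map_prod Inl Inl ` le_h P \<union> map_prod Inr Inr ` le_h Q)
     (map_prod Inl Inl ` le_r P \<union> map_prod Inr Inr ` le_r Q \<union> (Inl ` elems P) \<times> (Inr ` elems Q))"

definition h_sum :: "'a dposet \<Rightarrow> 'b dposet \<Rightarrow> ('a + 'b) dposet" where
  "h_sum P Q = DPoset (elems P <+> elems Q)
     (map_prod Inl Inl ` le_h P \<union> map_prod Inr Inr ` le_h Q \<union> (Inl ` elems P) \<times> (Inr ` elems Q))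
     (map_prod Inl Inl ` le_r P \<union> map_prod Inr Inr ` le_r Q)"

definition relabel :: "('a \<Rightarrow> 'b) \<Rightarrow> 'a dposet \<Rightarrow> 'b dposet" where
  "relabel f P = DPoset (f ` elems P) (map_prod f f ` le_h P) (map_prod f f ` le_r P)"

definition ideal :: "'a dposet \<Rightarrow> 'a set \<Rightarrow> bool" where
  "ideal R I \<longleftrightarrow> I \<subseteq> elems R \<and> (\<forall>x\<in>I. \<forall>y\<in>elems R. (x, y) \<in> le_h R \<longrightarrow> y \<in> I)"

definition cut_ideals :: "'a dposet \<Rightarrow> 'b dposet \<Rightarrow> 'c dposet \<Rightarrow> 'c set set" where
  "cut_ideals P Q R = {I. ideal R I \<and> dp_iso (subposet R (elems R - I)) P \<and> dp_iso (subposet R I) Q}"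


section \<open>Well-definedness on isomorphism classes\<close>

lemma same_ordersD:
  assumes "same_orders f P Q" "x \<in> elems P" "y \<in> elems P"
  shows "((x, y) \<in> le_h P \<longleftrightarrow> (f x, f y) \<in> le_h Q) \<and> ((x, y) \<in> le_r P \<longleftrightarrow> (f x, f y) \<in> le_r Q)"
  using assms unfolding same_orders_def by blast

lemma dp_iso_refl: "dp_iso P P"
  unfolding dp_iso_def by (rule exI[of _ id]) (auto simp: same_orders_def)

lemma dp_iso_sym:
  assumes "dp_iso P Q" shows "dp_iso Q P"
proof -
  obtain f where f: "bij_betw f (elems P) (elems Q)"
    and rel0: "same_orders f P Q"
    using assms unfolding dp_iso_def by blast
  note rel = same_ordersD[OF rel0]
  let ?g = "inv_into (elems P) f"
  have g: "bij_betw ?g (elems Q) (elems P)" by (rule bij_betw_inv_into[OF f])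
  have fg: "f (?g y) = y" "?g y \<in> elems P" if "y \<in> elems Q" for y
    using f g that by (auto simp: bij_betw_inv_into_right bij_betw_def)
  show ?thesis unfolding dp_iso_def same_orders_def
    using g rel fg by (intro exI[of _ ?g]) auto
qed

lemma dp_iso_trans:
  assumes "dp_iso P Q" "dp_iso Q R" shows "dp_iso P R"
proof -
  obtain f where f: "bij_betw f (elems P) (elems Q)"
    and relf0: "same_orders f P Q"
    using assms(1) unfolding dp_iso_def by blast
  note relf = same_ordersD[OF relf0]
  obtain g where g: "bij_betw g (elems Q) (elems R)"
    and relg0: "same_orders g Q R"
    using assms(2) unfolding dp_iso_def by blast
  note relg = same_ordersD[OF relg0]
  have fm: "f x \<in> elems Q" if "x \<in> elems P" for x using f that by (auto simp: bij_betw_def)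
  show ?thesis unfolding dp_iso_def same_orders_def
    using bij_betw_trans[OF f g] relf relg fm by (intro exI[of _ "g \<circ> f"]) auto
qed

lemma dp_iso_card: "dp_iso P Q \<Longrightarrow> card (elems P) = card (elems Q)"
  unfolding dp_iso_def using bij_betw_same_card by blast

lemma dposet_sel_subposet [simp]:
  "elems (subposet P S) = S" "le_h (subposet P S) = le_h P \<inter> S \<times> S"
  "le_r (subposet P S) = le_r P \<inter> S \<times> S"
  by (simp_all add: subposet_def)

lemma dposet_sel_relabel [simp]:
  "elems (relabel f P) = f ` elems P" "le_h (relabel f P) = map_prod f f ` le_h P"
  "le_r (relabel f P) = map_prod f f ` le_r P"
  by (simp_all add: relabel_def)

lemma double_poset_field:
  assumes "double_poset P"
  shows "(x, y) \<in> le_h P \<Longrightarrow> x \<in> elems P \<and> y \<in> elems P"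
    and "(x, y) \<in> le_r P \<Longrightarrow> x \<in> elems P \<and> y \<in> elems P"
  using assms by (auto simp: double_poset_def order_on_defs)

lemma mem_map_prod_image:
  assumes "inj_on f A" "r \<subseteq> A \<times> A" "x \<in> A" "y \<in> A"
  shows "(f x, f y) \<in> map_prod f f ` r \<longleftrightarrow> (x, y) \<in> r"
proof
  assume "(f x, f y) \<in> map_prod f f ` r"
  then obtain a b where ab: "(a, b) \<in> r" "f x = f a" "f y = f b" by auto
  then have "a \<in> A" "b \<in> A" using assms(2) by auto
  then have "x = a" "y = b" using ab assms(1,3,4) by (auto dest: inj_onD)
  then show "(x, y) \<in> r" using ab by simp
qed auto

lemma dp_iso_relabel:
  assumes "double_poset P" "inj_on f (elems P)"
  shows "dp_iso P (relabel f P)"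
proof -
  have "le_h P \<subseteq> elems P \<times> elems P" "le_r P \<subseteq> elems P \<times> elems P"
    using assms(1) by (auto simp: double_poset_def order_on_defs)
  then have "same_orders f P (relabel f P)"
    using assms(2) by (simp add: same_orders_def mem_map_prod_image)
  then show ?thesis unfolding dp_iso_def using assms(2) by (auto simp: bij_betw_def)
qed

lemma partial_order_on_map:
  assumes "partial_order_on A r" "inj_on f A"
  shows "partial_order_on (f ` A) (map_prod f f ` r)"
proof -
  have sub: "r \<subseteq> A \<times> A" and re: "refl_on A r" and tr: "trans r" and an: "antisym r"
    using assms(1) by (auto simp: order_on_defs)
  have "map_prod f f ` r \<subseteq> f ` A \<times> f ` A" using sub by auto
  moreover have "refl_on (f ` A) (map_prod f f ` r)" using re by (auto simp: refl_on_def)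
  moreover have "trans (map_prod f f ` r)"
  proof (rule transI)
    fix x y z assume "(x, y) \<in> map_prod f f ` r" "(y, z) \<in> map_prod f f ` r"
    then obtain a b b' c where *: "(a, b) \<in> r" "(b', c) \<in> r" "x = f a" "y = f b" "y = f b'" "z = f c"
      by auto
    then have "b = b'" using sub assms(2) by (auto dest: inj_onD)
    then have "(a, c) \<in> r" using * tr by (auto dest: transD)
    then show "(x, z) \<in> map_prod f f ` r" using * by auto
  qed
  moreover have "antisym (map_prod f f ` r)"
  proof (rule antisymI)
    fix x y assume "(x, y) \<in> map_prod f f ` r" "(y, x) \<in> map_prod f f ` r"
    then obtain a b b' c where *: "(a, b) \<in> r" "(b', c) \<in> r" "x = f a" "y = f b" "y = f b'" "x = f c"
      by auto
    then have "b = b'" "a = c" using sub assms(2) by (auto dest: inj_onD)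
    then have "a = b" using * an by (auto dest: antisymD)
    then show "x = y" using * by auto
  qed
  ultimately show ?thesis by (simp add: order_on_defs)
qed

lemma double_poset_relabel:
  assumes "double_poset P" "inj_on f (elems P)"
  shows "double_poset (relabel f P)"
  using assms by (auto simp: double_poset_def intro: partial_order_on_map)

definition dp_embeds :: "'a dposet \<Rightarrow> 'b dposet \<Rightarrow> bool" where
  "dp_embeds N P \<longleftrightarrow> (\<exists>g. inj_on g (elems N) \<and> g ` elems N \<subseteq> elems P \<and> same_orders g N P)"

lemma dp_embeds_iff: "(\<exists>S\<subseteq>elems P. dp_iso (subposet P S) N) \<longleftrightarrow> dp_embeds N P"
proof
  assume "\<exists>S\<subseteq>elems P. dp_iso (subposet P S) N"
  then obtain S where S: "S \<subseteq> elems P" and "dp_iso N (subposet P S)"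
    using dp_iso_sym by blast
  then obtain g where g: "inj_on g (elems N)" "g ` elems N = S" "same_orders g N (subposet P S)"
    unfolding dp_iso_def bij_betw_def by auto
  then have "same_orders g N P" by (auto simp: same_orders_def)
  then show "dp_embeds N P" unfolding dp_embeds_def using g S by blast
next
  assume "dp_embeds N P"
  then obtain g where g: "inj_on g (elems N)" "g ` elems N \<subseteq> elems P" "same_orders g N P"
    unfolding dp_embeds_def by blast
  then have "same_orders g N (subposet P (g ` elems N))" by (auto simp: same_orders_def)
  then have "dp_iso N (subposet P (g ` elems N))"
    unfolding dp_iso_def using g(1) by (auto simp: bij_betw_def)
  then have "dp_iso (subposet P (g ` elems N)) N" by (rule dp_iso_sym)
  then show "\<exists>S\<subseteq>elems P. dp_iso (subposet P S) N" using g(2) by blast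
qed

lemma WN_iff: "WN P \<longleftrightarrow> plane_poset P \<and> \<not> dp_embeds N1 P \<and> \<not> dp_embeds N2 P"
  unfolding WN_def dp_embeds_iff[symmetric] by blast

lemma dp_embeds_iso:
  assumes "dp_embeds N P" "dp_iso P Q"
  shows "dp_embeds N Q"
proof -
  obtain g where g_0: "inj_on g (elems N)" "g ` elems N \<subseteq> elems P"
    and g_ord: "same_orders g N P"
    using assms(1) unfolding dp_embeds_def by blast
  note g = g_0 same_ordersD[OF g_ord]
  obtain f where f_0: "inj_on f (elems P)" "f ` elems P = elems Q"
    and f_ord: "same_orders f P Q"
    using assms(2) unfolding dp_iso_def bij_betw_def by blast
  note f = f_0 same_ordersD[OF f_ord]
  have gm: "g x \<in> elems P" if "x \<in> elems N" for x using g(2) that by blast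
  have "inj_on (f \<circ> g) (elems N)" using g f(1) by (meson comp_inj_on inj_on_subset)
  moreover have "(f \<circ> g) ` elems N \<subseteq> elems Q" using gm f(2) by auto
  ultimately show ?thesis
    unfolding dp_embeds_def same_orders_def using g(3) f(3) gm by (intro exI[of _ "f \<circ> g"]) simp
qed

lemma WN_iso:
  assumes "WN P" "dp_iso P Q" "double_poset Q"
  shows "WN Q"
proof -
  have "plane_poset Q"
  proof -
    obtain f where f_0: "f ` elems Q = elems P" "inj_on f (elems Q)"
    and f_ord: "same_orders f Q P"
    using dp_iso_sym[OF assms(2)] unfolding dp_iso_def bij_betw_def by blast
  note f = f_0 same_ordersD[OF f_ord]
    have P: "comparable (le_h P) x y \<longleftrightarrow> \<not> comparable (le_r P) x y"
      if "x \<in> elems P" "y \<in> elems P" "x \<noteq> y" for x y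
      using assms(1) that by (auto simp: WN_def plane_poset_def)
    have "comparable (le_h Q) x y \<longleftrightarrow> \<not> comparable (le_r Q) x y"
      if "x \<in> elems Q" "y \<in> elems Q" "x \<noteq> y" for x y
    proof -
      have "f x \<in> elems P" "f y \<in> elems P" "f x \<noteq> f y"
        using f(1,2) that by (auto dest: inj_onD)
      from P[OF this] show ?thesis using f(3) that by (simp add: comparable_def)
    qed
    then show ?thesis using assms(3) by (simp add: plane_poset_def)
  qed
  moreover have "\<not> dp_embeds N1 Q" "\<not> dp_embeds N2 Q"
    using assms(1) dp_embeds_iso[OF _ dp_iso_sym[OF assms(2)]] unfolding WN_iff by auto
  ultimately show ?thesis by (simp add: WN_iff)
qed

lemma WN_double_poset: "WN P \<Longrightarrow> double_poset P"
  by (simp add: WN_def plane_poset_def)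

lemma WN_relabel:
  assumes "WN P" "inj_on f (elems P)"
  shows "WN (relabel f P)"
  using assms WN_double_poset[OF assms(1)]
  by (blast intro: WN_iso dp_iso_relabel double_poset_relabel)

lemma dposet_sel_sum:
  "elems (r_sum P Q) = elems P <+> elems Q" "elems (h_sum P Q) = elems P <+> elems Q"
  by (simp_all add: r_sum_def h_sum_def)

lemma r_sum_le [simp]:
  "(Inl x, Inl x') \<in> le_h (r_sum P Q) \<longleftrightarrow> (x, x') \<in> le_h P"
  "(Inr y, Inr y') \<in> le_h (r_sum P Q) \<longleftrightarrow> (y, y') \<in> le_h Q"
  "(Inl x, Inr y) \<notin> le_h (r_sum P Q)" "(Inr y, Inl x) \<notin> le_h (r_sum P Q)"
  "(Inl x, Inl x') \<in> le_r (r_sum P Q) \<longleftrightarrow> (x, x') \<in> le_r P"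
  "(Inr y, Inr y') \<in> le_r (r_sum P Q) \<longleftrightarrow> (y, y') \<in> le_r Q"
  "(Inl x, Inr y) \<in> le_r (r_sum P Q) \<longleftrightarrow> x \<in> elems P \<and> y \<in> elems Q"
  "(Inr y, Inl x) \<notin> le_r (r_sum P Q)"
  by (auto simp: r_sum_def)

lemma h_sum_le [simp]:
  "(Inl x, Inl x') \<in> le_r (h_sum P Q) \<longleftrightarrow> (x, x') \<in> le_r P"
  "(Inr y, Inr y') \<in> le_r (h_sum P Q) \<longleftrightarrow> (y, y') \<in> le_r Q"
  "(Inl x, Inr y) \<notin> le_r (h_sum P Q)" "(Inr y, Inl x) \<notin> le_r (h_sum P Q)"
  "(Inl x, Inl x') \<in> le_h (h_sum P Q) \<longleftrightarrow> (x, x') \<in> le_h P"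
  "(Inr y, Inr y') \<in> le_h (h_sum P Q) \<longleftrightarrow> (y, y') \<in> le_h Q"
  "(Inl x, Inr y) \<in> le_h (h_sum P Q) \<longleftrightarrow> x \<in> elems P \<and> y \<in> elems Q"
  "(Inr y, Inl x) \<notin> le_h (h_sum P Q)"
  by (auto simp: h_sum_def)

lemma partial_order_on_sum:
  assumes "partial_order_on A r" "partial_order_on B s"
    and t: "\<And>x x'. (Inl x, Inl x') \<in> t \<longleftrightarrow> (x, x') \<in> r"
      "\<And>y y'. (Inr y, Inr y') \<in> t \<longleftrightarrow> (y, y') \<in> s"
      "\<And>x y. (Inl x, Inr y) \<in> t \<longleftrightarrow> c \<and> x \<in> A \<and> y \<in> B"
      "\<And>x y. (Inr y, Inl x) \<notin> t"
  shows "partial_order_on (A <+> B) t"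
proof -
  have r: "r \<subseteq> A \<times> A" "refl_on A r" "trans r" "antisym r"
    and s: "s \<subseteq> B \<times> B" "refl_on B s" "trans s" "antisym s"
    using assms(1,2) by (auto simp: order_on_defs)
  have rA: "a \<in> A" if "(a, b) \<in> r" for a b using that r(1) by auto
  have sB: "b \<in> B" if "(a, b) \<in> s" for a b using that s(1) by auto
  have tr: "(a, c) \<in> r" if "(a, b) \<in> r" "(b, c) \<in> r" for a b c using that r(3) by (meson transD)
  have ts: "(a, c) \<in> s" if "(a, b) \<in> s" "(b, c) \<in> s" for a b c using that s(3) by (meson transD)
  have "trans t"
  proof (rule transI)
    fix x y z assume "(x, y) \<in> t" "(y, z) \<in> t"
    then show "(x, z) \<in> t"
      by (cases x; cases y; cases z; simp add: t; blast intro: rA sB tr ts)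
  qed
  moreover have "antisym t"
  proof (rule antisymI)
    fix x y assume "(x, y) \<in> t" "(y, x) \<in> t"
    then show "x = y"
      by (cases x; cases y; simp add: t; blast intro: antisymD[OF r(4)] antisymD[OF s(4)])
  qed
  moreover have "refl_on (A <+> B) t" using r(2) s(2) by (auto simp: refl_on_def t)
  moreover have "t \<subseteq> (A <+> B) \<times> (A <+> B)"
  proof
    fix p assume p: "p \<in> t"
    obtain x y where xy: "p = (x, y)" by (cases p)
    show "p \<in> (A <+> B) \<times> (A <+> B)"
      using p r(1) s(1) unfolding xy by (cases x; cases y) (auto simp: t)
  qed
  ultimately show ?thesis by (simp add: order_on_defs)
qed

lemma comparable_sum [simp]:
  "comparable (le_h (r_sum P Q)) (Inl x) (Inl x') \<longleftrightarrow> comparable (le_h P) x x'"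
  "comparable (le_h (r_sum P Q)) (Inr y) (Inr y') \<longleftrightarrow> comparable (le_h Q) y y'"
  "comparable (le_r (r_sum P Q)) (Inl x) (Inl x') \<longleftrightarrow> comparable (le_r P) x x'"
  "comparable (le_r (r_sum P Q)) (Inr y) (Inr y') \<longleftrightarrow> comparable (le_r Q) y y'"
  "comparable (le_h (h_sum P Q)) (Inl x) (Inl x') \<longleftrightarrow> comparable (le_h P) x x'"
  "comparable (le_h (h_sum P Q)) (Inr y) (Inr y') \<longleftrightarrow> comparable (le_h Q) y y'"
  "comparable (le_r (h_sum P Q)) (Inl x) (Inl x') \<longleftrightarrow> comparable (le_r P) x x'"
  "comparable (le_r (h_sum P Q)) (Inr y) (Inr y') \<longleftrightarrow> comparable (le_r Q) y y'"
  by (simp_all add: comparable_def)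

lemma comparable_sum_mixed:
  "\<not> comparable (le_h (r_sum P Q)) (Inl x) (Inr y)" "\<not> comparable (le_h (r_sum P Q)) (Inr y) (Inl x)"
  "\<not> comparable (le_r (h_sum P Q)) (Inl x) (Inr y)" "\<not> comparable (le_r (h_sum P Q)) (Inr y) (Inl x)"
  "x \<in> elems P \<Longrightarrow> y \<in> elems Q \<Longrightarrow> comparable (le_r (r_sum P Q)) (Inl x) (Inr y)"
  "x \<in> elems P \<Longrightarrow> y \<in> elems Q \<Longrightarrow> comparable (le_r (r_sum P Q)) (Inr y) (Inl x)"
  "x \<in> elems P \<Longrightarrow> y \<in> elems Q \<Longrightarrow> comparable (le_h (h_sum P Q)) (Inl x) (Inr y)"
  "x \<in> elems P \<Longrightarrow> y \<in> elems Q \<Longrightarrow> comparable (le_h (h_sum P Q)) (Inr y) (Inl x)"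
  by (simp_all add: comparable_def)

lemma plane_poset_sum:
  assumes "plane_poset P" "plane_poset Q"
  shows "plane_poset (r_sum P Q)" "plane_poset (h_sum P Q)"
proof -
  have P: "finite (elems P)" "partial_order_on (elems P) (le_h P)" "partial_order_on (elems P) (le_r P)"
    and Q: "finite (elems Q)" "partial_order_on (elems Q) (le_h Q)" "partial_order_on (elems Q) (le_r Q)"
    using assms by (auto simp: plane_poset_def double_poset_def)
  have "partial_order_on (elems P <+> elems Q) (le_h (r_sum P Q))"
    by (rule partial_order_on_sum[OF P(2) Q(2), where c = False]) simp_all
  moreover have "partial_order_on (elems P <+> elems Q) (le_r (r_sum P Q))"
    by (rule partial_order_on_sum[OF P(3) Q(3), where c = True]) simp_all
  moreover have "partial_order_on (elems P <+> elems Q) (le_h (h_sum P Q))"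
    by (rule partial_order_on_sum[OF P(2) Q(2), where c = True]) simp_all
  moreover have "partial_order_on (elems P <+> elems Q) (le_r (h_sum P Q))"
    by (rule partial_order_on_sum[OF P(3) Q(3), where c = False]) simp_all
  ultimately have dp: "double_poset (r_sum P Q)" "double_poset (h_sum P Q)"
    using P(1) Q(1) by (simp_all add: double_poset_def dposet_sel_sum)
  have cP: "comparable (le_h P) x y \<longleftrightarrow> \<not> comparable (le_r P) x y"
    if "x \<in> elems P" "y \<in> elems P" "x \<noteq> y" for x y
    using assms(1) that by (simp add: plane_poset_def)
  have cQ: "comparable (le_h Q) x y \<longleftrightarrow> \<not> comparable (le_r Q) x y"
    if "x \<in> elems Q" "y \<in> elems Q" "x \<noteq> y" for x y
    using assms(2) that by (simp add: plane_poset_def)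
  have "comparable (le_h R) x y \<longleftrightarrow> \<not> comparable (le_r R) x y"
    if "R = r_sum P Q \<or> R = h_sum P Q" "x \<in> elems P <+> elems Q" "y \<in> elems P <+> elems Q" "x \<noteq> y"
    for R x y
    using that by (cases x; cases y) (auto simp: cP cQ comparable_sum_mixed)
  then show "plane_poset (r_sum P Q)" "plane_poset (h_sum P Q)"
    using dp by (simp_all add: plane_poset_def dposet_sel_sum)
qed

lemma N1_N2_field:
  "le_h N1 \<subseteq> elems N1 \<times> elems N1" "le_r N1 \<subseteq> elems N1 \<times> elems N1"
  "le_h N2 \<subseteq> elems N2 \<times> elems N2" "le_r N2 \<subseteq> elems N2 \<times> elems N2"
  unfolding N1_def N2_def dposet.sel by (intro Un_least Id_on_subset_Times; simp)+

lemma N1_N2_edges: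
  "(0, 2) \<in> le_h N1" "(0, 3) \<in> le_h N1" "(1, 3) \<in> le_h N1"
  "(0, 1) \<in> le_r N1" "(2, 1) \<in> le_r N1" "(2, 3) \<in> le_r N1"
  "(0, 2) \<in> le_h N2" "(1, 2) \<in> le_h N2" "(1, 3) \<in> le_h N2"
  "(0, 1) \<in> le_r N2" "(0, 3) \<in> le_r N2" "(2, 3) \<in> le_r N2"
  unfolding N1_def N2_def dposet.sel by blast+

lemma not_dp_embeds_sum:
  assumes emb: "dp_embeds N R" and N: "N = N1 \<or> N = N2"
    and R: "R = r_sum P Q \<or> R = h_sum P Q"
    and P: "\<not> dp_embeds N P" and Q: "\<not> dp_embeds N Q"
  shows False
proof -
  obtain g where g_0: "inj_on g (elems N)" "g ` elems N \<subseteq> elems R"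
    and g_ord: "same_orders g N R"
    using emb unfolding dp_embeds_def by blast
  note g = g_0 same_ordersD[OF g_ord]
  have el: "elems N = {0, 1, 2, 3}" using N by (auto simp: N1_def N2_def)
  have elR: "elems R = elems P <+> elems Q" using R by (auto simp: dposet_sel_sum)
  have N_sub: "le_h N \<subseteq> elems N \<times> elems N" "le_r N \<subseteq> elems N \<times> elems N"
    using N N1_N2_field by blast+
  define t where "t = (if R = r_sum P Q then le_h N else le_r N)"
  have side: "isl (g x) \<longleftrightarrow> isl (g y)" if "(x, y) \<in> t" for x y
  proof -
    have xy: "x \<in> elems N" "y \<in> elems N"
      using that N_sub by (auto simp: t_def split: if_splits)
    show ?thesis
    proof (cases "R = r_sum P Q")
      case True
      then have "(g x, g y) \<in> le_h (r_sum P Q)" using g(3)[OF xy] that by (simp add: t_def)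
      then show ?thesis by (cases "g x"; cases "g y") simp_all
    next
      case False
      then have "(g x, g y) \<in> le_r (h_sum P Q)" using g(3)[OF xy] that R by (auto simp: t_def)
      then show ?thesis by (cases "g x"; cases "g y") simp_all
    qed
  qed
  have "t = le_h N \<or> t = le_r N" by (simp add: t_def)
  then have "t = le_h N1 \<or> t = le_r N1 \<or> t = le_h N2 \<or> t = le_r N2" using N by blast
  then have "(0, 2) \<in> t \<and> (0, 3) \<in> t \<and> (1, 3) \<in> t \<or> (0, 1) \<in> t \<and> (2, 1) \<in> t \<and> (2, 3) \<in> t \<or>
        (0, 2) \<in> t \<and> (1, 2) \<in> t \<and> (1, 3) \<in> t \<or> (0, 1) \<in> t \<and> (0, 3) \<in> t \<and> (2, 3) \<in> t"
    using N1_N2_edges by (elim disjE) simp_all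
  then have same: "isl (g 0) = isl (g 1) \<and> isl (g 0) = isl (g 2) \<and> isl (g 0) = isl (g 3)"
    using side[of 0 1] side[of 0 2] side[of 0 3] side[of 1 2] side[of 1 3] side[of 2 1] side[of 2 3]
    by (elim disjE conjE) simp_all
  show False
  proof (cases "isl (g 0)")
    case True
    then have gi: "g x = Inl (projl (g x))" if "x \<in> elems N" for x
      using same that el by auto
    have "inj_on (projl \<circ> g) (elems N)"
      using g(1) gi by (metis (no_types, lifting) comp_def inj_on_def)
    moreover have "(projl \<circ> g) ` elems N \<subseteq> elems P"
    proof
      fix a assume "a \<in> (projl \<circ> g) ` elems N"
      then obtain x where x: "x \<in> elems N" "a = projl (g x)" by auto
      then have "Inl a \<in> elems R" using gi[OF x(1)] g(2) by auto
      then show "a \<in> elems P" by (auto simp: elR)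
    qed
    moreover have "same_orders (projl \<circ> g) N P"
      unfolding same_orders_def
    proof (intro ballI)
      fix x y assume xy: "x \<in> elems N" "y \<in> elems N"
      obtain a b where "g x = Inl a" "g y = Inl b" using gi[OF xy(1)] gi[OF xy(2)] by blast
      then show "((x, y) \<in> le_h N \<longleftrightarrow> ((projl \<circ> g) x, (projl \<circ> g) y) \<in> le_h P)
          \<and> ((x, y) \<in> le_r N \<longleftrightarrow> ((projl \<circ> g) x, (projl \<circ> g) y) \<in> le_r P)"
        using g(3)[OF xy] R by auto
    qed
    ultimately show False using P unfolding dp_embeds_def by blast
  next
    case False
    then have gi: "g x = Inr (projr (g x))" if "x \<in> elems N" for x
      using same that el by auto
    have "inj_on (projr \<circ> g) (elems N)"
      using g(1) gi by (metis (no_types, lifting) comp_def inj_on_def)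
    moreover have "(projr \<circ> g) ` elems N \<subseteq> elems Q"
    proof
      fix a assume "a \<in> (projr \<circ> g) ` elems N"
      then obtain x where x: "x \<in> elems N" "a = projr (g x)" by auto
      then have "Inr a \<in> elems R" using gi[OF x(1)] g(2) by auto
      then show "a \<in> elems Q" by (auto simp: elR)
    qed
    moreover have "same_orders (projr \<circ> g) N Q"
      unfolding same_orders_def
    proof (intro ballI)
      fix x y assume xy: "x \<in> elems N" "y \<in> elems N"
      obtain a b where "g x = Inr a" "g y = Inr b" using gi[OF xy(1)] gi[OF xy(2)] by blast
      then show "((x, y) \<in> le_h N \<longleftrightarrow> ((projr \<circ> g) x, (projr \<circ> g) y) \<in> le_h Q)
          \<and> ((x, y) \<in> le_r N \<longleftrightarrow> ((projr \<circ> g) x, (projr \<circ> g) y) \<in> le_r Q)"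
        using g(3)[OF xy] R by auto
    qed
    ultimately show False using Q unfolding dp_embeds_def by blast
  qed
qed

lemma WN_sum:
  assumes "WN P" "WN Q"
  shows "WN (r_sum P Q)" "WN (h_sum P Q)"
  using assms plane_poset_sum not_dp_embeds_sum unfolding WN_iff by metis+

lemma dp_iso_sum:
  assumes "dp_iso P P'" "dp_iso Q Q'"
  shows "dp_iso (r_sum P Q) (r_sum P' Q')" "dp_iso (h_sum P Q) (h_sum P' Q')"
proof -
  obtain f where f_0: "inj_on f (elems P)" "f ` elems P = elems P'"
    and f_ord: "same_orders f P P'"
    using assms(1) unfolding dp_iso_def bij_betw_def by blast
  note f = f_0 same_ordersD[OF f_ord]
  obtain g where g_0: "inj_on g (elems Q)" "g ` elems Q = elems Q'"
    and g_ord: "same_orders g Q Q'"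
    using assms(2) unfolding dp_iso_def bij_betw_def by blast
  note g = g_0 same_ordersD[OF g_ord]
  have "map_sum f g ` (elems P <+> elems Q) = elems P' <+> elems Q'"
    unfolding f(2)[symmetric] g(2)[symmetric] by (auto simp: Plus_def image_Un image_image)
  moreover have "inj_on (map_sum f g) (elems P <+> elems Q)"
  proof (rule inj_onI)
    fix x y assume "x \<in> elems P <+> elems Q" "y \<in> elems P <+> elems Q" "map_sum f g x = map_sum f g y"
    then show "x = y" using inj_onD[OF f(1)] inj_onD[OF g(1)] by (cases x; cases y) auto
  qed
  ultimately have bij: "bij_betw (map_sum f g) (elems P <+> elems Q) (elems P' <+> elems Q')"
    by (simp add: bij_betw_def)
  have m: "f x \<in> elems P'" if "x \<in> elems P" for x using f(2) that by blast
  have m': "g x \<in> elems Q'" if "x \<in> elems Q" for x using g(2) that by blast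
  have "same_orders (map_sum f g) R R'"
    if R: "R = r_sum P Q \<and> R' = r_sum P' Q' \<or> R = h_sum P Q \<and> R' = h_sum P' Q'" for R R'
    unfolding same_orders_def
  proof (intro ballI)
    fix x y assume "x \<in> elems R" "y \<in> elems R"
    then have xy: "x \<in> elems P <+> elems Q" "y \<in> elems P <+> elems Q"
      using R by (auto simp: dposet_sel_sum)
    show "((x, y) \<in> le_h R \<longleftrightarrow> (map_sum f g x, map_sum f g y) \<in> le_h R')
        \<and> ((x, y) \<in> le_r R \<longleftrightarrow> (map_sum f g x, map_sum f g y) \<in> le_r R')"
      using R xy same_ordersD[OF f_ord] same_ordersD[OF g_ord] m m'
      by (cases x; cases y) auto
  qed
  then show "dp_iso (r_sum P Q) (r_sum P' Q')" "dp_iso (h_sum P Q) (h_sum P' Q')"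
    unfolding dp_iso_def dposet_sel_sum using bij by blast+
qed

lemma subposet_iso:
  assumes "same_orders f R R'" and "inj_on f (elems R)" "S \<subseteq> elems R"
  shows "dp_iso (subposet R S) (subposet R' (f ` S))"
proof -
  have "inj_on f S" using assms(2,3) inj_on_subset by blast
  then show ?thesis
    unfolding dp_iso_def same_orders_def using same_ordersD[OF assms(1)] assms(3)
    by (intro exI[of _ f]) (auto simp: bij_betw_def subset_iff)
qed

lemma cut_ideals_image:
  assumes f: "inj_on f (elems R)" "f ` elems R = elems R'"
    "same_orders f R R'"
    and iso: "dp_iso P P'" "dp_iso Q Q'" and I: "I \<in> cut_ideals P Q R"
  shows "f ` I \<in> cut_ideals P' Q' R'"
proof -
  have I': "ideal R I" "dp_iso (subposet R (elems R - I)) P" "dp_iso (subposet R I) Q"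
    and sub: "I \<subseteq> elems R"
    using I by (auto simp: cut_ideals_def ideal_def)
  have "f ` (elems R - I) = elems R' - f ` I"
    using f(1,2) sub by (metis Diff_subset inj_on_image_set_diff)
  then have "dp_iso (subposet R (elems R - I)) (subposet R' (elems R' - f ` I))"
    using subposet_iso[OF f(3) f(1), of "elems R - I"] by auto
  then have "dp_iso (subposet R' (elems R' - f ` I)) P'"
    by (rule dp_iso_trans[OF dp_iso_sym dp_iso_trans[OF I'(2) iso(1)]])
  moreover have "dp_iso (subposet R' (f ` I)) Q'"
    by (rule dp_iso_trans[OF dp_iso_sym dp_iso_trans[OF I'(3) iso(2)]])
       (rule subposet_iso[OF f(3) f(1) sub])
  moreover have "ideal R' (f ` I)"
    unfolding ideal_def
  proof (intro conjI ballI impI)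
    show "f ` I \<subseteq> elems R'" using sub f(2) by blast
  next
    fix x' y' assume "x' \<in> f ` I" "y' \<in> elems R'" and le: "(x', y') \<in> le_h R'"
    then obtain x y where xy: "x \<in> I" "y \<in> elems R" "x' = f x" "y' = f y" using f(2) by blast
    then have "x \<in> elems R" using sub by blast
    then have "(x, y) \<in> le_h R" using same_ordersD[OF f(3)] le xy by blast
    then have "y \<in> I" using I'(1) xy by (auto simp: ideal_def)
    then show "y' \<in> f ` I" using xy by blast
  qed
  ultimately show ?thesis by (simp add: cut_ideals_def)
qed

lemma finite_cut_ideals: "finite (elems R) \<Longrightarrow> finite (cut_ideals P Q R)"
  by (rule finite_subset[of _ "Pow (elems R)"]) (auto simp: cut_ideals_def ideal_def)

lemma card_cut_ideals_le:
  assumes "dp_iso P P'" "dp_iso Q Q'" "dp_iso R R'" "finite (elems R')"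
  shows "card (cut_ideals P Q R) \<le> card (cut_ideals P' Q' R')"
proof -
  obtain f where f_0: "inj_on f (elems R)" "f ` elems R = elems R'"
    and f_ord: "same_orders f R R'"
    using assms(3) unfolding dp_iso_def bij_betw_def by blast
  note f = f_0 same_ordersD[OF f_ord]
  have "inj_on ((`) f) (cut_ideals P Q R)"
    by (rule inj_on_subset[OF inj_on_image_Pow[OF f(1)]]) (auto simp: cut_ideals_def ideal_def)
  moreover have "(`) f ` cut_ideals P Q R \<subseteq> cut_ideals P' Q' R'"
    using cut_ideals_image[OF f_0 f_ord assms(1,2)] by blast
  ultimately show ?thesis using finite_cut_ideals[OF assms(4)] by (rule card_inj_on_le)
qed

lemma card_cut_ideals_iso:
  assumes "dp_iso P P'" "dp_iso Q Q'" "dp_iso R R'" "finite (elems R)" "finite (elems R')"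
  shows "card (cut_ideals P Q R) = card (cut_ideals P' Q' R')"
  by (intro le_antisym card_cut_ideals_le assms dp_iso_sym[OF assms(1)]
      dp_iso_sym[OF assms(2)] dp_iso_sym[OF assms(3)])


section \<open>Isomorphism classes of WN posets\<close>

definition wn_iso :: "nat dposet \<Rightarrow> nat dposet \<Rightarrow> bool" where
  "wn_iso P Q \<longleftrightarrow> WN P \<and> WN Q \<and> dp_iso P Q"

lemma plane_poset_small:
  "plane_poset (DPoset {} {} {})" "plane_poset (DPoset {x} {(x, x)} {(x, x)})"
  by (auto simp: plane_poset_def double_poset_def order_on_defs refl_on_def trans_def antisym_def)

lemma WN_if_card_less_4:
  assumes "plane_poset P" "card (elems P) < 4"
  shows "WN P"
proof -
  have fin: "finite (elems P)" using assms(1) by (simp add: plane_poset_def double_poset_def)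
  have "\<not> dp_embeds N P" if "card (elems N) = 4" for N :: "nat dposet"
  proof
    assume "dp_embeds N P"
    then have "card (elems N) \<le> card (elems P)"
      unfolding dp_embeds_def using card_inj_on_le[OF _ _ fin] by blast
    then show False using that assms(2) by simp
  qed
  moreover have "card (elems N1) = 4" "card (elems N2) = 4" by (simp_all add: N1_def N2_def)
  ultimately show ?thesis using assms(1) unfolding WN_iff by blast
qed

lemma WN_small: "WN (DPoset {} {} {})" "WN (DPoset {x} {(x, x)} {(x, x)})"
  by (rule WN_if_card_less_4; simp add: plane_poset_small)+

text \<open>
  Every finite double poset has an isomorphic copy carried by a set of natural numbers, so
  the classes of WN posets with elements in \<open>nat\<close> are all the isomorphism classes.
\<close>

quotient_type wnp = "nat dposet" / partial: wn_iso
proof (rule part_equivpI)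
  show "\<exists>P. wn_iso P P" using WN_small(1) dp_iso_refl by (auto simp: wn_iso_def)
  show "symp wn_iso" by (auto simp: symp_def wn_iso_def intro: dp_iso_sym)
  show "transp wn_iso" unfolding transp_def wn_iso_def by (blast intro: dp_iso_trans)
qed

lift_definition wn_empty :: wnp is "DPoset {} {} {}"
  by (simp add: wn_iso_def WN_small dp_iso_refl)

lift_definition wn_point :: wnp is "DPoset {0} {(0, 0)} {(0, 0)}"
  by (simp add: wn_iso_def WN_small dp_iso_refl)

lemma wn_iso_relabel:
  assumes "WN P" "WN P'" "dp_iso P P'" "inj f"
  shows "wn_iso (relabel f P) (relabel f P')"
proof -
  have i: "inj_on f A" for A using assms(4) inj_on_subset by blast
  have "dp_iso P (relabel f P)" "dp_iso P' (relabel f P')"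
    using assms WN_double_poset i by (blast intro: dp_iso_relabel)+
  then have "dp_iso (relabel f P) (relabel f P')"
    using assms(3) dp_iso_sym dp_iso_trans by metis
  then show ?thesis using assms(1,2) i by (simp add: wn_iso_def WN_relabel)
qed

text \<open>The injection \<open>sum_encode\<close> only transports the disjoint union back to \<open>nat\<close>.\<close>

lift_definition wn_r_sum :: "wnp \<Rightarrow> wnp \<Rightarrow> wnp" is "\<lambda>P Q. relabel sum_encode (r_sum P Q)"
  by (rule wn_iso_relabel) (auto simp: wn_iso_def WN_sum dp_iso_sum inj_sum_encode)

lift_definition wn_h_sum :: "wnp \<Rightarrow> wnp \<Rightarrow> wnp" is "\<lambda>P Q. relabel sum_encode (h_sum P Q)"
  by (rule wn_iso_relabel) (auto simp: wn_iso_def WN_sum dp_iso_sum inj_sum_encode)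

lift_definition wn_cuts :: "wnp \<Rightarrow> wnp \<Rightarrow> wnp \<Rightarrow> nat" is "\<lambda>P Q R. card (cut_ideals P Q R)"
  by (rule card_cut_ideals_iso)
     (auto simp: wn_iso_def dest: WN_double_poset simp: double_poset_def)

lemma finite_wn_cuts: "finite {R. wn_cuts P Q R \<noteq> 0}"
proof -
  define n where "n = card (elems (rep_wnp P)) + card (elems (rep_wnp Q))"
  define F where "F = case_prod (DPoset {..<n}) ` (Pow ({..<n} \<times> {..<n}) \<times> Pow ({..<n} \<times> {..<n}))"
  have "finite F" unfolding F_def by (intro finite_imageI finite_cartesian_product) auto
  moreover have "{R. wn_cuts P Q R \<noteq> 0} \<subseteq> abs_wnp ` F"
  proof
    fix R assume "R \<in> {R. wn_cuts P Q R \<noteq> 0}"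
    then have "card (cut_ideals (rep_wnp P) (rep_wnp Q) (rep_wnp R)) \<noteq> 0"
      by (simp add: wn_cuts.rep_eq)
    then obtain I where "I \<in> cut_ideals (rep_wnp P) (rep_wnp Q) (rep_wnp R)"
      by (metis card.empty ex_in_conv)
    then have I: "I \<subseteq> elems (rep_wnp R)"
      "card (elems (rep_wnp R) - I) = card (elems (rep_wnp P))" "card I = card (elems (rep_wnp Q))"
      by (auto simp: cut_ideals_def ideal_def dest: dp_iso_card)
    have "wn_iso (rep_wnp R) (rep_wnp R)"
      by (meson Quotient_rep_reflp Quotient_wnp)
    then have R: "WN (rep_wnp R)" by (simp add: wn_iso_def)
    then have dR: "double_poset (rep_wnp R)" and fin: "finite (elems (rep_wnp R))"
      by (auto dest: WN_double_poset simp: double_poset_def)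
    have "card (elems (rep_wnp R)) = n"
      using I fin unfolding n_def
      by (metis card_Diff_subset card_mono finite_subset le_add_diff_inverse2)
    then obtain f where f: "bij_betw f (elems (rep_wnp R)) {..<n}"
      using fin by (metis ex_bij_betw_finite_nat lessThan_atLeast0)
    then have inj: "inj_on f (elems (rep_wnp R))" by (simp add: bij_betw_def)
    let ?R = "relabel f (rep_wnp R)"
    have el: "elems ?R = {..<n}" using f by (simp add: bij_betw_def)
    have "double_poset ?R" by (rule double_poset_relabel[OF dR inj])
    then have "le_h ?R \<subseteq> {..<n} \<times> {..<n}" "le_r ?R \<subseteq> {..<n} \<times> {..<n}"
      unfolding el[symmetric] double_poset_def order_on_defs by blast+
    then have "?R \<in> F"
      unfolding F_def using el
      by (intro image_eqI[of _ _ "(le_h ?R, le_r ?R)"]) (auto simp: dposet.expand)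
    moreover have "wn_iso (rep_wnp R) ?R"
      using R inj dR by (simp add: wn_iso_def WN_relabel dp_iso_relabel)
    then have "R = abs_wnp ?R"
      by (metis Quotient_abs_rep Quotient_rel Quotient_wnp)
    ultimately show "R \<in> abs_wnp ` F" by blast
  qed
  ultimately show ?thesis using finite_surj by blast
qed


section \<open>The vector space with basis the isomorphism classes of WN posets\<close>

type_synonym 'k hwnp = "wnp \<Rightarrow>\<^sub>0 'k"

definition h_scale :: "'k::field \<Rightarrow> 'k hwnp \<Rightarrow> 'k hwnp" where
  "h_scale c x = Poly_Mapping.map ((*) c) x"

definition basis :: "wnp \<Rightarrow> 'k::field hwnp" where
  "basis P = Poly_Mapping.single P 1"

definition bilinear_ext :: "(wnp \<Rightarrow> wnp \<Rightarrow> 'k::field hwnp) \<Rightarrow> 'k hwnp \<Rightarrow> 'k hwnp \<Rightarrow> 'k hwnp" where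
  "bilinear_ext b x y =
     (\<Sum>P\<in>Poly_Mapping.keys x. \<Sum>Q\<in>Poly_Mapping.keys y.
        h_scale (Poly_Mapping.lookup x P * Poly_Mapping.lookup y Q) (b P Q))"

definition h_one :: "'k::field hwnp" where
  "h_one = basis wn_empty"

definition h_point :: "'k::field hwnp" where
  "h_point = basis wn_point"

definition h_leadsto :: "'k::field hwnp \<Rightarrow> 'k hwnp \<Rightarrow> 'k hwnp" where
  "h_leadsto = bilinear_ext (\<lambda>P Q. basis (wn_r_sum P Q))"

definition h_natural :: "'k::field hwnp \<Rightarrow> 'k hwnp \<Rightarrow> 'k hwnp" where
  "h_natural = bilinear_ext (\<lambda>P Q. basis (wn_h_sum P Q))"

text \<open>The index set of the sum is finite by \<open>finite_wn_cuts\<close>.\<close>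

definition h_star :: "'k::field hwnp \<Rightarrow> 'k hwnp \<Rightarrow> 'k hwnp" where
  "h_star = bilinear_ext
     (\<lambda>P Q. \<Sum>R | wn_cuts P Q R \<noteq> 0. h_scale (of_nat (wn_cuts P Q R)) (basis R))"


section \<open>2-As algebras\<close>

locale unital_assoc_algebra = vector_space scale
  for scale :: "'k::field \<Rightarrow> 'a::ab_group_add \<Rightarrow> 'a" +
  fixes mult :: "'a \<Rightarrow> 'a \<Rightarrow> 'a" and one :: 'a
  assumes mult_add_left: "mult (x + y) z = mult x z + mult y z"
    and mult_add_right: "mult x (y + z) = mult x y + mult x z"
    and mult_scale_left: "mult (scale c x) y = scale c (mult x y)"
    and mult_scale_right: "mult x (scale c y) = scale c (mult x y)"
    and mult_assoc: "mult (mult x y) z = mult x (mult y z)"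
    and mult_one_left: "mult one x = x"
    and mult_one_right: "mult x one = x"

locale two_as_algebra =
  dot: unital_assoc_algebra scale dot one + ast: unital_assoc_algebra scale ast one
  for scale :: "'k::field \<Rightarrow> 'a::ab_group_add \<Rightarrow> 'a" and dot ast :: "'a \<Rightarrow> 'a \<Rightarrow> 'a" and one :: 'a

locale two_as_morphism =
  source: two_as_algebra scale1 dot1 ast1 one1 +
  target: two_as_algebra scale2 dot2 ast2 one2 +
  Vector_Spaces.linear scale1 scale2 f
  for scale1 :: "'k::field \<Rightarrow> 'a::ab_group_add \<Rightarrow> 'a" and dot1 ast1 :: "'a \<Rightarrow> 'a \<Rightarrow> 'a" and one1 :: 'a
    and scale2 :: "'k::field \<Rightarrow> 'b::ab_group_add \<Rightarrow> 'b" and dot2 ast2 :: "'b \<Rightarrow> 'b \<Rightarrow> 'b" and one2 :: 'b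
    and f :: "'a \<Rightarrow> 'b" +
  assumes map_one: "f one1 = one2"
    and map_dot: "f (dot1 x y) = dot2 (f x) (f y)"
    and map_ast: "f (ast1 x y) = ast2 (f x) (f y)"

text \<open>
  The universal property of the free 2-As algebra on one generator \<open>x\<close>, tested against all
  2-As algebras over \<open>'k\<close> whose underlying type is \<open>'b\<close>. HOL cannot quantify over types inside
  a formula; the full universal property is the statement that this holds with \<open>'b\<close> a
  (schematic) type variable of class \<^class>\<open>ab_group_add\<close>.
\<close>

definition two_as_free_on ::
  "'b::ab_group_add itself \<Rightarrow> ('k::field \<Rightarrow> 'a::ab_group_add \<Rightarrow> 'a)
     \<Rightarrow> ('a \<Rightarrow> 'a \<Rightarrow> 'a) \<Rightarrow> ('a \<Rightarrow> 'a \<Rightarrow> 'a) \<Rightarrow> 'a \<Rightarrow> 'a \<Rightarrow> bool" where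
  "two_as_free_on B scale dot ast one x \<longleftrightarrow>
     two_as_algebra scale dot ast one \<and>
     (\<forall>(scale' :: 'k \<Rightarrow> 'b \<Rightarrow> 'b) dot' ast' one' y.
        two_as_algebra scale' dot' ast' one' \<longrightarrow>
        (\<exists>!f. two_as_morphism scale dot ast one scale' dot' ast' one' f \<and> f x = y))"

end

theory Submission
  imports Defs
begin

text \<open>
  Write \<open>swap\<close> for the exchange of the two orders of a double poset. It maps WN posets to WN
  posets and turns \<open>wn_r_sum\<close> into \<open>wn_h_sum\<close> and back. The morphism \<open>\<phi>\<close> replaces \<open>wn_r_sum\<close> by the
  product \<open>h_star\<close> and \<open>wn_h_sum\<close> by \<open>wn_r_sum\<close>. Counting the relations of the order \<open>le_h\<close> shows
  that \<open>\<phi>\<close> is unitriangular with respect to \<open>swap\<close>: a poset \<open>R\<close> that occurs in \<open>P \<star> Q\<close> consists of a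
  copy of \<open>P\<close>, a copy of \<open>Q\<close>, and \<open>h\<close>-relations from the first to the second, so that it has at
  most as many \<open>h\<close>-relations as \<open>wn_h_sum P Q\<close>. Equality forces \<open>R = wn_h_sum P Q\<close>, in which exactly
  one ideal has the right form, so that its coefficient is \<open>1\<close> (\<open>leads_h_star\<close>). By induction
  \<open>\<phi> P = swap P + (posets of the same size with fewer h-relations)\<close> (\<open>leads_morphism\<close>). Because \<open>swap\<close>
  is an involution and the leading coefficients are \<open>1\<close>, \<open>\<phi>\<close> is bijective over every field, of any
  characteristic (\<open>bij_if_leads\<close>).

  This argument rests on the freeness of the algebra with the products \<open>h_leadsto\<close> and
  \<open>h_natural\<close>, which holds because the set of classes of WN posets, with the operations \<open>wn_r_sum\<close>
  and \<open>wn_h_sum\<close>, is the free set with two associative operations sharing their unit, on one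
  generator (\<open>wnp_universal\<close>). Three facts give this: a WN poset with at least two elements
  decomposes for one of the two sums (\<open>wnp_decompose\<close>), never for both (\<open>r_sum_neq_h_sum\<close>), and two
  decompositions for the same sum have a common refinement (\<open>r_sum_refine\<close>). All three are statements
  about cuts, that is subsets all of whose elements lie below all the others for one of the two
  orders.

  That \<open>h_star\<close> is an associative product follows from its description as a convolution over the
  ideals of a poset (\<open>lookup_h_star\<close>). Finally, freeness is carried along the isomorphism \<open>\<phi>\<close>
  (\<open>two_as_free_transport\<close>).
\<close>

section \<open>Exchanging the two orders\<close>

text \<open>
  The class of WN posets is stable under this exchange, so every fact about \<open>r_sum\<close> yields the
  corresponding fact about \<open>h_sum\<close>.
\<close>

definition swap_orders :: "'a dposet \<Rightarrow> 'a dposet" where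
  "swap_orders P = DPoset (elems P) (le_r P) (le_h P)"

lemma swap_orders_sel [simp]:
  "elems (swap_orders P) = elems P" "le_h (swap_orders P) = le_r P"
  "le_r (swap_orders P) = le_h P"
  by (simp_all add: swap_orders_def)

lemma swap_orders_swap [simp]: "swap_orders (swap_orders P) = P"
  by (simp add: swap_orders_def)

lemma subposet_swap: "subposet (swap_orders P) S = swap_orders (subposet P S)"
  by (simp add: swap_orders_def subposet_def)

lemma dp_iso_swap [simp]: "dp_iso (swap_orders P) (swap_orders Q) \<longleftrightarrow> dp_iso P Q"
  unfolding dp_iso_def same_orders_def by auto

lemma plane_poset_swap [simp]: "plane_poset (swap_orders P) \<longleftrightarrow> plane_poset P"
  unfolding plane_poset_def double_poset_def by auto

text \<open>
  The two forbidden patterns are exchanged, after the two middle vertices are renamed into each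
  other.
\<close>

lemma swap_N1: "dp_iso (swap_orders N1) N2"
  unfolding dp_iso_def
proof (intro exI conjI)
  let ?f = "\<lambda>i::nat. if i = 1 then 2 else if i = 2 then 1 else i"
  show "bij_betw ?f (elems (swap_orders N1)) (elems N2)"
    by (auto simp: bij_betw_def inj_on_def N1_def N2_def)
  show "same_orders ?f (swap_orders N1) N2"
    by (simp add: same_orders_def N1_def N2_def Id_on_iff)
qed

lemma WN_swap [simp]: "WN (swap_orders P) \<longleftrightarrow> WN P"
proof -
  have 1: "dp_iso (swap_orders X) N2 \<longleftrightarrow> dp_iso X N1" for X :: "'a dposet"
    by (metis dp_iso_swap dp_iso_sym dp_iso_trans swap_N1)
  have 2: "dp_iso (swap_orders X) N1 \<longleftrightarrow> dp_iso X N2" for X :: "'a dposet"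
    by (metis 1 swap_orders_swap)
  show ?thesis unfolding WN_def by (auto simp: subposet_swap 1 2)
qed

lemma swap_r_sum: "swap_orders (r_sum P Q) = h_sum (swap_orders P) (swap_orders Q)"
  by (simp add: swap_orders_def r_sum_def h_sum_def)

lemma swap_h_sum: "swap_orders (h_sum P Q) = r_sum (swap_orders P) (swap_orders Q)"
  by (simp add: swap_orders_def r_sum_def h_sum_def)

lemma swap_relabel: "swap_orders (relabel f P) = relabel f (swap_orders P)"
  by (simp add: swap_orders_def relabel_def)

section \<open>Cuts of plane posets\<close>

lemma subposet_subposet [simp]: "S \<subseteq> A \<Longrightarrow> subposet (subposet P A) S = subposet P S"
  unfolding subposet_def by auto

lemma double_poset_subposet: "double_poset P \<Longrightarrow> S \<subseteq> elems P \<Longrightarrow> double_poset (subposet P S)"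
  unfolding double_poset_def order_on_defs refl_on_def trans_def antisym_def
  by (auto intro: finite_subset)

lemma WN_subposet: "WN P \<Longrightarrow> S \<subseteq> elems P \<Longrightarrow> WN (subposet P S)"
  unfolding WN_def
proof (elim conjE, intro conjI)
  assume "plane_poset P" "S \<subseteq> elems P"
  then show "plane_poset (subposet P S)"
    using double_poset_subposet[of P S] by (auto simp: plane_poset_def comparable_def subset_iff)
next
  assume "S \<subseteq> elems P" "\<nexists>T. T \<subseteq> elems P \<and> (dp_iso (subposet P T) N1 \<or> dp_iso (subposet P T) N2)"
  then show "\<nexists>T. T \<subseteq> elems (subposet P S) \<and>
      (dp_iso (subposet (subposet P S) T) N1 \<or> dp_iso (subposet (subposet P S) T) N2)"
    by (metis dposet_sel_subposet(1) subposet_subposet subset_trans)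
qed

text \<open>
  Cuts are the decompositions \<open>R = r_sum P Q\<close> (and \<open>R = h_sum P Q\<close>) read inside the fixed poset \<open>R\<close>: the cut is
  the part isomorphic to \<open>P\<close>. Working with subsets of one poset replaces the comparison of
  isomorphisms by set theory.
\<close>

definition r_cut :: "'a dposet \<Rightarrow> 'a set \<Rightarrow> bool" where
  "r_cut R S \<longleftrightarrow> S \<subseteq> elems R \<and> (\<forall>x\<in>S. \<forall>y\<in>elems R - S. (x, y) \<in> le_r R)"

definition h_cut :: "'a dposet \<Rightarrow> 'a set \<Rightarrow> bool" where
  "h_cut R S \<longleftrightarrow> S \<subseteq> elems R \<and> (\<forall>x\<in>S. \<forall>y\<in>elems R - S. (x, y) \<in> le_h R)"

lemma cut_swap [simp]:
  "r_cut (swap_orders R) S \<longleftrightarrow> h_cut R S" "h_cut (swap_orders R) S \<longleftrightarrow> r_cut R S"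
  by (simp_all add: r_cut_def h_cut_def)

lemma plane_poset_rules:
  assumes "plane_poset R"
  shows "(x, y) \<in> le_h R \<Longrightarrow> (y, z) \<in> le_h R \<Longrightarrow> (x, z) \<in> le_h R"
    and "(x, y) \<in> le_r R \<Longrightarrow> (y, z) \<in> le_r R \<Longrightarrow> (x, z) \<in> le_r R"
    and "(x, y) \<in> le_h R \<Longrightarrow> (y, x) \<in> le_h R \<Longrightarrow> x = y"
    and "(x, y) \<in> le_r R \<Longrightarrow> (y, x) \<in> le_r R \<Longrightarrow> x = y"
    and "x \<in> elems R \<Longrightarrow> (x, x) \<in> le_h R"
    and "x \<in> elems R \<Longrightarrow> (x, x) \<in> le_r R"
    and "(x, y) \<in> le_h R \<Longrightarrow> (x, y) \<in> le_r R \<Longrightarrow> x = y"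
    and "(x, y) \<in> le_h R \<Longrightarrow> (y, x) \<in> le_r R \<Longrightarrow> x = y"
    and "x \<in> elems R \<Longrightarrow> y \<in> elems R \<Longrightarrow>
      (x, y) \<in> le_h R \<or> (y, x) \<in> le_h R \<or> (x, y) \<in> le_r R \<or> (y, x) \<in> le_r R"
proof -
  have *: "double_poset R" "finite (elems R)"
    "partial_order_on (elems R) (le_h R)" "partial_order_on (elems R) (le_r R)"
    and p: "\<And>x y. x \<in> elems R \<Longrightarrow> y \<in> elems R \<Longrightarrow> x \<noteq> y \<Longrightarrow>
        comparable (le_h R) x y \<longleftrightarrow> \<not> comparable (le_r R) x y"
    using assms by (auto simp: plane_poset_def double_poset_def)
  show "(x, y) \<in> le_h R \<Longrightarrow> (y, z) \<in> le_h R \<Longrightarrow> (x, z) \<in> le_h R"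
    "(x, y) \<in> le_r R \<Longrightarrow> (y, z) \<in> le_r R \<Longrightarrow> (x, z) \<in> le_r R"
    using *(3,4) by (meson order_on_defs transD)+
  show "(x, y) \<in> le_h R \<Longrightarrow> (y, x) \<in> le_h R \<Longrightarrow> x = y"
    "(x, y) \<in> le_r R \<Longrightarrow> (y, x) \<in> le_r R \<Longrightarrow> x = y"
    using *(3,4) by (meson order_on_defs antisymD)+
  show r: "x \<in> elems R \<Longrightarrow> (x, x) \<in> le_h R" "x \<in> elems R \<Longrightarrow> (x, x) \<in> le_r R" for x
    using *(3,4) by (meson order_on_defs refl_onD)+
  show "(x, y) \<in> le_h R \<Longrightarrow> (x, y) \<in> le_r R \<Longrightarrow> x = y"
    "(x, y) \<in> le_h R \<Longrightarrow> (y, x) \<in> le_r R \<Longrightarrow> x = y"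
    using p[of x y] double_poset_field(1)[OF *(1)] by (auto simp: comparable_def)
  show "x \<in> elems R \<Longrightarrow> y \<in> elems R \<Longrightarrow>
      (x, y) \<in> le_h R \<or> (y, x) \<in> le_h R \<or> (x, y) \<in> le_r R \<or> (y, x) \<in> le_r R"
    using p[of x y] r[of x] by (auto simp: comparable_def)
qed

lemma plane_poset_strict:
  assumes "plane_poset R" "x \<noteq> y"
  shows "(x, y) \<in> le_h R \<Longrightarrow> (y, x) \<notin> le_h R \<and> (x, y) \<notin> le_r R \<and> (y, x) \<notin> le_r R"
    and "(x, y) \<in> le_r R \<Longrightarrow> (y, x) \<notin> le_r R \<and> (x, y) \<notin> le_h R \<and> (y, x) \<notin> le_h R"
  using plane_poset_rules(3,4,7,8)[OF assms(1), of x y]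
    plane_poset_rules(3,4,7,8)[OF assms(1), of y x] assms(2) by blast+

lemma r_cut_iso_r_sum:
  assumes "plane_poset R" "r_cut R S"
  shows "dp_iso R (r_sum (subposet R S) (subposet R (elems R - S)))"
  unfolding dp_iso_def
proof (intro exI conjI)
  let ?f = "\<lambda>x. if x \<in> S then Inl x else Inr x"
  have S: "S \<subseteq> elems R" "\<And>x y. x \<in> S \<Longrightarrow> y \<in> elems R - S \<Longrightarrow> (x, y) \<in> le_r R"
    using assms(2) by (auto simp: r_cut_def)
  note pl = plane_poset_rules[OF assms(1)]
  show "bij_betw ?f (elems R) (elems (r_sum (subposet R S) (subposet R (elems R - S))))"
    using S(1) by (auto simp: bij_betw_def inj_on_def dposet_sel_sum split: if_splits)
  show "same_orders ?f R (r_sum (subposet R S) (subposet R (elems R - S)))"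
    using S pl(4,7,8) by (auto simp: same_orders_def) (blast+)?
qed

lemma r_cut_of_iso_r_sum:
  assumes "dp_iso R (r_sum A B)"
  obtains S where "r_cut R S" "dp_iso (subposet R S) A" "dp_iso (subposet R (elems R - S)) B"
proof -
  obtain f where f: "bij_betw f (elems R) (elems A <+> elems B)" and "same_orders f R (r_sum A B)"
    using assms by (auto simp: dp_iso_def dposet_sel_sum)
  note o = same_ordersD[OF this(2)]
  define S where "S = {x \<in> elems R. isl (f x)}"
  have inj: "inj_on f (elems R)" and im: "f ` elems R = elems A <+> elems B"
    using f by (auto simp: bij_betw_def)
  have l: "f x = Inl (projl (f x))" "projl (f x) \<in> elems A" if "x \<in> S" for x
  proof -
    have "f x \<in> elems A <+> elems B" "isl (f x)" using that im by (auto simp: S_def)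
    then show "f x = Inl (projl (f x))" "projl (f x) \<in> elems A" by auto
  qed
  have r: "f x = Inr (projr (f x))" "projr (f x) \<in> elems B" if "x \<in> elems R - S" for x
  proof -
    have "f x \<in> elems A <+> elems B" "\<not> isl (f x)" using that im by (auto simp: S_def)
    then show "f x = Inr (projr (f x))" "projr (f x) \<in> elems B" by auto
  qed
  have sub: "S \<subseteq> elems R" by (auto simp: S_def)
  have "r_cut R S"
    unfolding r_cut_def
  proof (intro conjI ballI sub)
    fix x y assume xy: "x \<in> S" "y \<in> elems R - S"
    then have "(f x, f y) \<in> le_r (r_sum A B)"
      using l[OF xy(1)] r[OF xy(2)] by (metis r_sum_le(7))
    then show "(x, y) \<in> le_r R" using o[of x y] xy sub by auto
  qed
  moreover have "dp_iso (subposet R S) A"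
    unfolding dp_iso_def
  proof (intro exI conjI)
    have "inj_on (projl \<circ> f) S"
    proof (rule inj_onI)
      fix x y assume xy: "x \<in> S" "y \<in> S" "(projl \<circ> f) x = (projl \<circ> f) y"
      then have "f x = f y" using l(1)[OF xy(1)] l(1)[OF xy(2)] by simp
      then show "x = y" using inj xy(1,2) sub by (auto dest: inj_onD)
    qed
    moreover have "(projl \<circ> f) ` S = elems A"
    proof
      show "elems A \<subseteq> (projl \<circ> f) ` S"
      proof
        fix a assume "a \<in> elems A"
        then have "Inl a \<in> f ` elems R" using im by auto
        then obtain x where "x \<in> elems R" "f x = Inl a" by auto
        then show "a \<in> (projl \<circ> f) ` S" by (force simp: S_def)
      qed
    qed (use l in auto)
    ultimately show "bij_betw (projl \<circ> f) (elems (subposet R S)) (elems A)"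
      by (simp add: bij_betw_def)
    show "same_orders (projl \<circ> f) (subposet R S) A"
      unfolding same_orders_def
    proof (intro ballI)
      fix x y assume "x \<in> elems (subposet R S)" "y \<in> elems (subposet R S)"
      then have xy: "x \<in> S" "y \<in> S" by auto
      obtain a b where "f x = Inl a" "f y = Inl b" using l(1) xy by blast
      then show "((x, y) \<in> le_h (subposet R S) \<longleftrightarrow> ((projl \<circ> f) x, (projl \<circ> f) y) \<in> le_h A) \<and>
        ((x, y) \<in> le_r (subposet R S) \<longleftrightarrow> ((projl \<circ> f) x, (projl \<circ> f) y) \<in> le_r A)"
        using o[of x y] xy sub by auto
    qed
  qed
  moreover have "dp_iso (subposet R (elems R - S)) B"
    unfolding dp_iso_def
  proof (intro exI conjI)
    have "inj_on (projr \<circ> f) (elems R - S)"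
    proof (rule inj_onI)
      fix x y
      assume xy: "x \<in> elems R - S" "y \<in> elems R - S" "(projr \<circ> f) x = (projr \<circ> f) y"
      then have "f x = f y" using r(1)[OF xy(1)] r(1)[OF xy(2)] by simp
      then show "x = y" using inj xy(1,2) by (auto dest: inj_onD)
    qed
    moreover have "(projr \<circ> f) ` (elems R - S) = elems B"
    proof
      show "elems B \<subseteq> (projr \<circ> f) ` (elems R - S)"
      proof
        fix a assume "a \<in> elems B"
        then have "Inr a \<in> f ` elems R" using im by auto
        then obtain x where "x \<in> elems R" "f x = Inr a" by auto
        then show "a \<in> (projr \<circ> f) ` (elems R - S)" by (force simp: S_def)
      qed
    qed (use r in auto)
    ultimately show "bij_betw (projr \<circ> f) (elems (subposet R (elems R - S))) (elems B)"
      by (simp add: bij_betw_def)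
    show "same_orders (projr \<circ> f) (subposet R (elems R - S)) B"
      unfolding same_orders_def
    proof (intro ballI)
      fix x y
      assume "x \<in> elems (subposet R (elems R - S))" "y \<in> elems (subposet R (elems R - S))"
      then have xy: "x \<in> elems R - S" "y \<in> elems R - S" by auto
      obtain a b where "f x = Inr a" "f y = Inr b" using r(1) xy by blast
      then show "((x, y) \<in> le_h (subposet R (elems R - S))
            \<longleftrightarrow> ((projr \<circ> f) x, (projr \<circ> f) y) \<in> le_h B) \<and>
        ((x, y) \<in> le_r (subposet R (elems R - S))
            \<longleftrightarrow> ((projr \<circ> f) x, (projr \<circ> f) y) \<in> le_r B)"
        using o[of x y] xy by auto
    qed
  qed
  ultimately show ?thesis by (rule that)
qed

lemma h_cut_iso_h_sum:
  assumes "plane_poset R" "h_cut R S"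
  shows "dp_iso R (h_sum (subposet R S) (subposet R (elems R - S)))"
  using r_cut_iso_r_sum[of "swap_orders R" S] assms
  by (metis cut_swap(1) dp_iso_swap plane_poset_swap subposet_swap swap_h_sum swap_orders_sel(1))

lemma h_cut_of_iso_h_sum:
  assumes "dp_iso R (h_sum A B)"
  obtains S where "h_cut R S" "dp_iso (subposet R S) A" "dp_iso (subposet R (elems R - S)) B"
proof -
  have "dp_iso (swap_orders R) (r_sum (swap_orders A) (swap_orders B))"
    using assms by (simp flip: swap_h_sum)
  then obtain S where "r_cut (swap_orders R) S"
    "dp_iso (subposet (swap_orders R) S) (swap_orders A)"
    "dp_iso (subposet (swap_orders R) (elems (swap_orders R) - S)) (swap_orders B)"
    by (rule r_cut_of_iso_r_sum)
  then show ?thesis using that[of S] by (simp add: subposet_swap)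
qed

text \<open>
  Cuts form a chain: elements \<open>x \<in> S - S'\<close> and \<open>y \<in> S' - S\<close> would lie below each other. This is what
  makes decompositions for one sum unique up to refinement.
\<close>

lemma r_cut_subset:
  assumes "plane_poset R" "r_cut R S" "r_cut R S'" "card S \<le> card S'"
  shows "S \<subseteq> S'"
proof (rule ccontr)
  assume "\<not> S \<subseteq> S'"
  then obtain x where x: "x \<in> S" "x \<notin> S'" by blast
  have "finite S" "finite S'"
    using assms(1-3) by (auto simp: plane_poset_def double_poset_def r_cut_def intro: finite_subset)
  then have "\<not> S' \<subseteq> S" using assms(4) x by (metis card_seteq)
  then obtain y where y: "y \<in> S'" "y \<notin> S" by blast
  have "(x, y) \<in> le_r R" "(y, x) \<in> le_r R"
    using assms(2,3) x y by (auto simp: r_cut_def)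
  then show False using plane_poset_rules(4)[OF assms(1)] x y by blast
qed

lemma h_cut_subset:
  assumes "plane_poset R" "h_cut R S" "h_cut R S'" "card S \<le> card S'"
  shows "S \<subseteq> S'"
  using r_cut_subset[of "swap_orders R" S S'] assms by simp

text \<open>
  A pair separated by an \<open>r\<close>-cut is not \<open>h\<close>-comparable, hence lies on one side of any \<open>h\<close>-cut.
  The pairs separated by a proper cut form a connected (complete bipartite) graph, so an \<open>h\<close>-cut
  would contain everything or nothing.
\<close>

lemma not_r_cut_and_h_cut:
  assumes "plane_poset R" "r_cut R S" "S \<noteq> {}" "S \<noteq> elems R"
    and "h_cut R T" "T \<noteq> {}" "T \<noteq> elems R"
  shows False
proof -
  have no: "x \<in> T \<longleftrightarrow> y \<in> T" if "x \<in> S" "y \<in> elems R - S" for x y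
  proof -
    have "(x, y) \<in> le_r R" "x \<noteq> y" "x \<in> elems R" using that assms(2) by (auto simp: r_cut_def)
    then have "(x, y) \<notin> le_h R" "(y, x) \<notin> le_h R"
      using plane_poset_strict(2)[OF assms(1)] by blast+
    then show ?thesis using assms(5) that \<open>x \<in> elems R\<close> by (auto simp: h_cut_def)
  qed
  obtain s s' where s: "s \<in> S" "s' \<in> elems R - S"
    using assms(2-4) by (auto simp: r_cut_def)
  have "x \<in> T \<longleftrightarrow> s \<in> T" if "x \<in> elems R" for x
    using no[OF s] no[of x s'] no[of s x] s that by blast
  then show False using assms(5-7) by (auto simp: h_cut_def)
qed

text \<open>
  It suffices to give the six strict relations: every pair is then related, and planarity excludes
  all the other relations.
\<close>

lemma dp_embeds_N1I:
  assumes pl: "plane_poset R" and el: "{a, b, c, d} \<subseteq> elems R" and dist: "distinct [a, b, c, d]"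
    and h: "(a, c) \<in> le_h R" "(a, d) \<in> le_h R" "(b, d) \<in> le_h R"
    and r: "(a, b) \<in> le_r R" "(c, b) \<in> le_r R" "(c, d) \<in> le_r R"
  shows "dp_embeds N1 R"
proof -
  define g where "g = (\<lambda>i::nat. if i = 0 then a else if i = 1 then b else if i = 2 then c else d)"
  have ne: "a \<noteq> c" "a \<noteq> d" "b \<noteq> d" "a \<noteq> b" "c \<noteq> b" "c \<noteq> d" using dist by auto
  note f = plane_poset_strict(1)[OF pl ne(1) h(1)] plane_poset_strict(1)[OF pl ne(2) h(2)]
    plane_poset_strict(1)[OF pl ne(3) h(3)] plane_poset_strict(2)[OF pl ne(4) r(1)]
    plane_poset_strict(2)[OF pl ne(5) r(2)] plane_poset_strict(2)[OF pl ne(6) r(3)]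
  have refl: "(x, x) \<in> le_h R" "(x, x) \<in> le_r R" if "x \<in> {a, b, c, d}" for x
    using plane_poset_rules(5,6)[OF pl] that el by auto
  have "inj_on g (elems N1)" using ne by (simp add: g_def N1_def inj_on_def)
  moreover have "g ` elems N1 \<subseteq> elems R" using el by (simp add: g_def N1_def)
  moreover have "same_orders g N1 R"
    using h r f refl[of a] refl[of b] refl[of c] refl[of d]
    by (simp add: same_orders_def N1_def g_def Id_on_iff)
  ultimately show ?thesis by (auto simp: dp_embeds_def)
qed

text \<open>
  The inductive step for the existence of cuts, obtained by removing a maximum \<open>v\<close> of the union of
  the two orders. Let \<open>S\<close> be a cut of the rest, let \<open>T\<close> be its complement there, and let \<open>D\<close> and \<open>E\<close>
  be the sets of elements that lie below \<open>v\<close> for \<open>r\<close> and for \<open>h\<close>. If \<open>S\<close> does not meet \<open>E\<close> then \<open>S\<close>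
  remains a cut. Otherwise \<open>T \<subseteq> E\<close>; then everything except \<open>v\<close> is an \<open>h\<close>-cut if \<open>D\<close> is empty, and
  otherwise \<open>D\<close> is an \<open>r\<close>-cut, because a pair in \<open>D \<times> E\<close> violating this would form a copy of \<open>N1\<close>
  with \<open>v\<close> and any element of \<open>T\<close>.
\<close>

lemma cut_extend_max:
  assumes "WN R" and v: "v \<in> elems R" "\<And>x. x \<in> elems R \<Longrightarrow> (x, v) \<in> le_h R \<or> (x, v) \<in> le_r R"
    and S: "r_cut (subposet R (elems R - {v})) S" "S \<noteq> {}" "S \<noteq> elems R - {v}"
  shows "\<exists>S'. S' \<noteq> {} \<and> S' \<noteq> elems R \<and> (r_cut R S' \<or> h_cut R S')"
proof -
  have pl: "plane_poset R" using assms(1) by (simp add: WN_def)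
  note p = plane_poset_rules[OF pl]
  have Ssub: "S \<subseteq> elems R - {v}" using S(1) by (simp add: r_cut_def)
  define T where "T = elems R - {v} - S"
  have T: "T \<noteq> {}" "T \<subseteq> elems R - {v}" using S Ssub by (auto simp: T_def)
  have ST: "(x, y) \<in> le_r R" if "x \<in> S" "y \<in> T" for x y
    using that S(1) by (auto simp: r_cut_def T_def)
  define D where "D = {x \<in> elems R - {v}. (x, v) \<in> le_r R}"
  define E where "E = {x \<in> elems R - {v}. (x, v) \<in> le_h R}"
  have disj: "D \<inter> E = {}" using p(7) by (auto simp: D_def E_def)
  show ?thesis
  proof (cases "S \<inter> E = {}")
    case True
    have "(x, y) \<in> le_r R" if "x \<in> S" "y \<in> elems R - S" for x y
    proof (cases "y = v")
      case True
      then show ?thesis using \<open>S \<inter> E = {}\<close> that(1) Ssub v(2)[of x] by (auto simp: E_def)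
    next
      case False
      then show ?thesis using that by (intro ST) (auto simp: T_def)
    qed
    then have "r_cut R S" using Ssub by (auto simp: r_cut_def)
    then show ?thesis using S(2) Ssub v(1) by blast
  next
    case False
    then obtain x where x: "x \<in> S" "(x, v) \<in> le_h R" by (auto simp: E_def)
    have TE: "T \<subseteq> E"
    proof
      fix y assume y: "y \<in> T"
      have "(y, v) \<notin> le_r R"
        using p(2)[OF ST[OF x(1) y]] p(7)[OF x(2)] x(1) Ssub by blast
      then show "y \<in> E" using v(2)[of y] y T(2) by (auto simp: E_def)
    qed
    show ?thesis
    proof (cases "D = {}")
      case True
      have "(y, v) \<in> le_h R" if "y \<in> elems R - {v}" for y
        using that v(2)[of y] True by (auto simp: D_def)
      then have "h_cut R (elems R - {v})" by (auto simp: h_cut_def)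
      then show ?thesis using v(1) x Ssub by blast
    next
      case Dne: False
      have "(x, y) \<in> le_r R" if xy: "x \<in> D" "y \<in> E" for x y
      proof (rule ccontr)
        assume n: "(x, y) \<notin> le_r R"
        have el: "x \<in> elems R" "y \<in> elems R" "x \<noteq> v" "y \<noteq> v" "x \<noteq> y"
          "(x, v) \<in> le_r R" "(y, v) \<in> le_h R"
          using xy disj by (auto simp: D_def E_def)
        have "(x, y) \<notin> le_h R" using p(1)[of x y v] p(7)[of x v] el by blast
        moreover have "(y, x) \<notin> le_r R" using p(2)[of y x v] p(7)[of y v] el by blast
        ultimately have yx: "(y, x) \<in> le_h R" using p(9)[of x y] n el by blast
        have xS: "x \<in> S" using xy TE disj Ssub by (auto simp: T_def D_def)
        have yS: "y \<in> S" using ST[OF xS, of y] n el by (auto simp: T_def)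
        obtain z where z: "z \<in> T" using T by blast
        then have zE: "z \<in> elems R" "z \<noteq> v" "(z, v) \<in> le_h R" "z \<notin> S" using TE
          by (auto simp: E_def T_def)
        have rz: "(x, z) \<in> le_r R" "(y, z) \<in> le_r R" using ST xS yS z by auto
        have ne: "z \<noteq> x" "z \<noteq> y" using zE xS yS by auto
        have "dp_embeds N1 R"
          by (rule dp_embeds_N1I[OF pl, of y z x v]) (use el zE ne rz yx v(1) in auto)
        then show False using assms(1) by (simp add: WN_iff)
      qed
      moreover have "D \<subseteq> elems R" "elems R - D \<subseteq> insert v E" "\<forall>x\<in>D. (x, v) \<in> le_r R"
        using v(2) by (auto simp: D_def E_def)
      ultimately have "r_cut R D" by (auto simp: r_cut_def)
      moreover have "D \<noteq> elems R" using v(1) by (auto simp: D_def)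
      ultimately show ?thesis using Dne by blast
    qed
  qed
qed

text \<open>
  The union of the two orders of a plane poset is a total order. Transitivity is the only point
  that is not immediate.
\<close>

lemma plane_poset_le_trans:
  assumes pl: "plane_poset R"
    and xy: "(x, y) \<in> le_h R \<union> le_r R" and yz: "(y, z) \<in> le_h R \<union> le_r R"
  shows "(x, z) \<in> le_h R \<union> le_r R"
proof -
  note p = plane_poset_rules[OF pl]
  have dp: "double_poset R" using pl by (simp add: plane_poset_def)
  have el: "x \<in> elems R" "z \<in> elems R" using xy yz double_poset_field[OF dp] by auto
  have "x = z" if "(x, y) \<in> le_h R" "(y, z) \<in> le_r R" "(z, x) \<in> le_h R \<union> le_r R"
    using that p(1)[of z x y] p(2)[of y z x] p(8)[of z y] p(8)[of x y] p(4)[of x z] p(3)[of x z]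
    by blast
  moreover have "x = z" if "(x, y) \<in> le_r R" "(y, z) \<in> le_h R" "(z, x) \<in> le_h R \<union> le_r R"
    using that p(2)[of z x y] p(1)[of y z x] p(8)[of y z] p(8)[of y x] p(4)[of x z] p(3)[of x z]
    by blast
  ultimately show ?thesis
    using xy yz p(1)[of x y z] p(2)[of x y z] p(9)[OF el] p(5)[OF el(1)] by blast
qed

lemma plane_poset_ex_max:
  assumes "plane_poset R" "elems R \<noteq> {}"
  obtains v where "v \<in> elems R" "\<And>x. x \<in> elems R \<Longrightarrow> (x, v) \<in> le_h R \<or> (x, v) \<in> le_r R"
proof -
  note p = plane_poset_rules[OF assms(1)]
  have fin: "finite (elems R)" using assms(1) by (simp add: plane_poset_def double_poset_def)
  have "\<exists>v\<in>A. \<forall>x\<in>A. (x, v) \<in> le_h R \<or> (x, v) \<in> le_r R" if "A \<subseteq> elems R" "A \<noteq> {}" for A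
    using finite_subset[OF that(1) fin] that(2,1)
  proof (induction rule: finite_ne_induct)
    case (singleton x)
    then show ?case using p(5) by auto
  next
    case (insert a A)
    then obtain v where v: "v \<in> A" "\<forall>x\<in>A. (x, v) \<in> le_h R \<or> (x, v) \<in> le_r R" by auto
    have el: "a \<in> elems R" "v \<in> elems R" "\<forall>x\<in>A. x \<in> elems R" using insert v(1) by auto
    show ?case
    proof (cases "(a, v) \<in> le_h R \<or> (a, v) \<in> le_r R")
      case True
      then show ?thesis using v by blast
    next
      case False
      then have va: "(v, a) \<in> le_h R \<or> (v, a) \<in> le_r R" using p(9)[of a v] el by blast
      have "(x, a) \<in> le_h R \<or> (x, a) \<in> le_r R" if "x \<in> A" for x
        using plane_poset_le_trans[OF assms(1), of x v a] v(2) that va by blast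
      then show ?thesis using p(5) el by blast
    qed
  qed
  from this[of "elems R"] show ?thesis using that assms(2) by blast
qed

text \<open>
  Removing a maximum, the rest has a cut for one of the two orders. Exchanging the orders if
  necessary, this is an \<open>r\<close>-cut, which extends by \<open>cut_extend_max\<close>.
\<close>

lemma WN_ex_cut:
  assumes "WN R" "card (elems R) \<ge> 2"
  shows "\<exists>S. S \<noteq> {} \<and> S \<noteq> elems R \<and> (r_cut R S \<or> h_cut R S)"
  using assms
proof (induction "card (elems R)" arbitrary: R rule: less_induct)
  case less
  have pl: "plane_poset R" and fin: "finite (elems R)"
    using less.prems(1) by (auto simp: WN_def plane_poset_def double_poset_def)
  have "elems R \<noteq> {}" using less.prems(2) by auto
  with plane_poset_ex_max[OF pl] obtain v
    where v: "v \<in> elems R" "\<And>x. x \<in> elems R \<Longrightarrow> (x, v) \<in> le_h R \<or> (x, v) \<in> le_r R"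
    by metis
  let ?R = "subposet R (elems R - {v})"
  have card: "card (elems R - {v}) = card (elems R) - 1" using v(1) fin by simp
  show ?case
  proof (cases "card (elems R) \<ge> 3")
    case True
    have "WN ?R" using less.prems(1) by (auto intro: WN_subposet)
    moreover have "card (elems ?R) < card (elems R)" "card (elems ?R) \<ge> 2"
      using True card by simp_all
    ultimately obtain S where S: "S \<noteq> {}" "S \<noteq> elems ?R" "r_cut ?R S \<or> h_cut ?R S"
      using less.hyps[of ?R] by blast
    then have "S \<noteq> elems R - {v}" by simp
    note S = S(1) this S(3)
    from S(3) show ?thesis
    proof
      assume "r_cut ?R S"
      from cut_extend_max[OF less.prems(1) v this S(1,2)] show ?thesis .
    next
      assume "h_cut ?R S"
      then have "r_cut (subposet (swap_orders R) (elems (swap_orders R) - {v})) S"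
        by (simp add: subposet_swap)
      then have "\<exists>S'. S' \<noteq> {} \<and> S' \<noteq> elems (swap_orders R) \<and>
          (r_cut (swap_orders R) S' \<or> h_cut (swap_orders R) S')"
        by (rule cut_extend_max[rotated 3]) (use less.prems(1) v S(1,2) in auto)
      then show ?thesis by auto
    qed
  next
    case False
    then have "card (elems R - {v}) = 1" using card less.prems(2) by linarith
    then obtain x where x: "elems R - {v} = {x}" by (auto simp: card_1_singleton_iff)
    then have "elems R = {x, v}" "x \<noteq> v" using v(1) by auto
    then have "r_cut R {x} \<or> h_cut R {x}" using v(2)[of x] by (auto simp: r_cut_def h_cut_def)
    moreover have "{x} \<noteq> elems R" using \<open>elems R = {x, v}\<close> \<open>x \<noteq> v\<close> by simp
    ultimately show ?thesis by blast
  qed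
qed

section \<open>The two sums on isomorphism classes\<close>

lemma abs_wnp_eq_iff: "WN P \<Longrightarrow> WN Q \<Longrightarrow> abs_wnp P = abs_wnp Q \<longleftrightarrow> dp_iso P Q"
  using Quotient_rel[OF Quotient_wnp, of P Q] by (simp add: wn_iso_def dp_iso_refl)

lemma WN_rep_wnp [simp]: "WN (rep_wnp x)"
  using Quotient_rep_reflp[OF Quotient_wnp, of x] by (simp add: wn_iso_def)

lemma abs_rep_wnp [simp]: "abs_wnp (rep_wnp x) = x"
  by (rule Quotient_abs_rep[OF Quotient_wnp])

lemma wnp_cases:
  obtains P where "WN P" "x = abs_wnp P"
  using that[of "rep_wnp x"] by simp

lemma wn_iso_refl: "WN P \<Longrightarrow> wn_iso P P"
  by (simp add: wn_iso_def dp_iso_refl)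

lemma dp_iso_relabel_sum_encode:
  assumes "WN P" shows "dp_iso (relabel sum_encode P) P"
  using dp_iso_relabel[OF WN_double_poset[OF assms] inj_on_subset[OF inj_sum_encode]]
  by (blast intro: dp_iso_sym)

lemma WN_relabel_sum_encode: "WN P \<Longrightarrow> WN (relabel sum_encode P)"
  by (rule WN_relabel) (blast intro: inj_on_subset[OF inj_sum_encode])+

lemma abs_eq_r_sum_iff:
  assumes "WN R" "WN P" "WN Q"
  shows "abs_wnp R = wn_r_sum (abs_wnp P) (abs_wnp Q) \<longleftrightarrow> dp_iso R (r_sum P Q)"
  using assms dp_iso_relabel_sum_encode[OF WN_sum(1)[OF assms(2,3)]]
  by (simp add: wn_r_sum.abs_eq wn_iso_refl abs_wnp_eq_iff WN_relabel_sum_encode WN_sum)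
     (blast intro: dp_iso_sym dp_iso_trans)

lemma abs_eq_h_sum_iff:
  assumes "WN R" "WN P" "WN Q"
  shows "abs_wnp R = wn_h_sum (abs_wnp P) (abs_wnp Q) \<longleftrightarrow> dp_iso R (h_sum P Q)"
  using assms dp_iso_relabel_sum_encode[OF WN_sum(2)[OF assms(2,3)]]
  by (simp add: wn_h_sum.abs_eq wn_iso_refl abs_wnp_eq_iff WN_relabel_sum_encode WN_sum)
     (blast intro: dp_iso_sym dp_iso_trans)

lift_definition wn_size :: "wnp \<Rightarrow> nat" is "\<lambda>P. card (elems P)"
  by (auto simp: wn_iso_def dp_iso_card)

lemma wn_size_abs: "WN P \<Longrightarrow> wn_size (abs_wnp P) = card (elems P)"
  by (simp add: wn_size.abs_eq wn_iso_refl)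

lemma card_le_h_cong:
  assumes "double_poset P" "double_poset Q" "dp_iso P Q"
  shows "card (le_h P) = card (le_h Q)"
proof -
  obtain f where f: "bij_betw f (elems P) (elems Q)" and "same_orders f P Q"
    using assms(3) by (auto simp: dp_iso_def)
  note o = same_ordersD[OF this(2)]
  have inj: "inj_on f (elems P)" and im: "f ` elems P = elems Q"
    using f by (auto simp: bij_betw_def)
  note fP = double_poset_field(1)[OF assms(1)] and fQ = double_poset_field(1)[OF assms(2)]
  have "bij_betw (map_prod f f) (le_h P) (le_h Q)"
    unfolding bij_betw_def
  proof
    have "inj_on (map_prod f f) (elems P \<times> elems P)" by (rule map_prod_inj_on[OF inj inj])
    then show "inj_on (map_prod f f) (le_h P)" by (rule inj_on_subset) (use fP in auto)
    show "map_prod f f ` le_h P = le_h Q"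
    proof
      show "map_prod f f ` le_h P \<subseteq> le_h Q"
      proof
        fix q assume "q \<in> map_prod f f ` le_h P"
        then obtain x y where "q = (f x, f y)" "(x, y) \<in> le_h P" by auto
        then show "q \<in> le_h Q" using fP[of x y] o[of x y] by blast
      qed
      show "le_h Q \<subseteq> map_prod f f ` le_h P"
      proof
        fix q assume q: "q \<in> le_h Q"
        obtain a b where ab: "q = (a, b)" by (cases q)
        then have "a \<in> f ` elems P" "b \<in> f ` elems P" using fQ[of a b] q im by simp_all
        then obtain x y where xy: "x \<in> elems P" "y \<in> elems P" "a = f x" "b = f y" by auto
        then have "(x, y) \<in> le_h P" using o[of x y] q ab by blast
        then show "q \<in> map_prod f f ` le_h P" using ab xy by force
      qed
    qed
  qed
  then show ?thesis by (rule bij_betw_same_card)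
qed

text \<open>
  The reflexive pairs are included; they only add the size, which is additive for both sums.
\<close>

lift_definition wn_h_count :: "wnp \<Rightarrow> nat" is "\<lambda>P. card (le_h P)"
  by (auto simp: wn_iso_def intro: card_le_h_cong WN_double_poset)

lemma wn_h_count_abs: "WN P \<Longrightarrow> wn_h_count (abs_wnp P) = card (le_h P)"
  by (simp add: wn_h_count.abs_eq wn_iso_refl)

lift_definition wn_swap :: "wnp \<Rightarrow> wnp" is swap_orders
  by (auto simp: wn_iso_def)

lemma wn_swap_abs: "WN P \<Longrightarrow> wn_swap (abs_wnp P) = abs_wnp (swap_orders P)"
  by (simp add: wn_swap.abs_eq wn_iso_refl)

lemma wn_swap_swap [simp]: "wn_swap (wn_swap x) = x"
  by (cases x rule: wnp_cases) (simp add: wn_swap_abs)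

lemma wn_size_swap [simp]: "wn_size (wn_swap x) = wn_size x"
  by (cases x rule: wnp_cases) (simp add: wn_swap_abs wn_size_abs)

lemma wn_swap_r_sum: "wn_swap (wn_r_sum a b) = wn_h_sum (wn_swap a) (wn_swap b)"
proof -
  obtain A B where "WN A" "a = abs_wnp A" "WN B" "b = abs_wnp B" by (meson wnp_cases)
  then show ?thesis
    by (simp add: wn_r_sum.abs_eq wn_h_sum.abs_eq wn_iso_refl wn_swap_abs
        WN_relabel_sum_encode WN_sum swap_relabel swap_r_sum)
qed

lemma wn_swap_h_sum: "wn_swap (wn_h_sum a b) = wn_r_sum (wn_swap a) (wn_swap b)"
  by (metis wn_swap_r_sum wn_swap_swap)

lemma wn_size_r_sum [simp]: "wn_size (wn_r_sum a b) = wn_size a + wn_size b"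
proof -
  obtain A B where *: "WN A" "a = abs_wnp A" "WN B" "b = abs_wnp B" by (meson wnp_cases)
  then have "finite (elems A)" "finite (elems B)" by (auto dest: WN_double_poset simp: double_poset_def)
  with * show ?thesis
    by (simp add: wn_r_sum.abs_eq wn_iso_refl wn_size_abs WN_relabel_sum_encode WN_sum
        card_image inj_sum_encode dposet_sel_sum card_Plus)
qed

lemma wn_size_h_sum [simp]: "wn_size (wn_h_sum a b) = wn_size a + wn_size b"
  by (metis wn_size_r_sum wn_size_swap wn_swap_h_sum)

lemma finite_le_h: "WN P \<Longrightarrow> finite (le_h P)"
  using WN_double_poset[of P]
  by (auto simp: double_poset_def order_on_defs intro: finite_subset[of _ "elems P \<times> elems P"])

lemma card_le_h_r_sum:
  assumes "WN A" "WN B"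
  shows "card (le_h (r_sum A B)) = card (le_h A) + card (le_h B)"
proof -
  have *: "card (map_prod Inl Inl ` le_h A :: (('a + 'b) \<times> ('a + 'b)) set) = card (le_h A)"
    "card (map_prod Inr Inr ` le_h B :: (('a + 'b) \<times> ('a + 'b)) set) = card (le_h B)"
    by (rule card_image; auto simp: inj_on_def)+
  have "card (map_prod Inl Inl ` le_h A \<union> map_prod Inr Inr ` le_h B)
      = card (map_prod Inl Inl ` le_h A :: (('a + 'b) \<times> ('a + 'b)) set)
        + card (map_prod Inr Inr ` le_h B :: (('a + 'b) \<times> ('a + 'b)) set)"
    by (rule card_Un_disjoint) (auto simp: finite_le_h assms)
  then show ?thesis by (simp add: r_sum_def *)
qed

lemma card_le_h_h_sum:
  assumes "WN A" "WN B"
  shows "card (le_h (h_sum A B)) = card (le_h A) + card (le_h B) + card (elems A) * card (elems B)"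
proof -
  let ?L = "Inl ` elems A :: ('a + 'b) set" and ?R = "Inr ` elems B :: ('a + 'b) set"
  have fin: "finite (elems A)" "finite (elems B)"
    using assms by (auto dest: WN_double_poset simp: double_poset_def)
  have "le_h (h_sum A B) = le_h (r_sum A B) \<union> ?L \<times> ?R" by (simp add: h_sum_def r_sum_def)
  moreover have "card (le_h (r_sum A B) \<union> ?L \<times> ?R) = card (le_h (r_sum A B)) + card (?L \<times> ?R)"
    by (rule card_Un_disjoint) (auto simp: fin finite_le_h WN_sum assms)
  ultimately show ?thesis
    by (simp add: card_le_h_r_sum assms card_cartesian_product card_image)
qed

lemma wn_h_count_r_sum [simp]: "wn_h_count (wn_r_sum a b) = wn_h_count a + wn_h_count b"
proof -
  obtain A B where *: "WN A" "a = abs_wnp A" "WN B" "b = abs_wnp B" by (meson wnp_cases)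
  let ?R = "relabel sum_encode (r_sum A B)"
  have "card (le_h ?R) = card (le_h (r_sum A B))"
    using * by (intro card_le_h_cong WN_double_poset WN_relabel_sum_encode
        dp_iso_relabel_sum_encode WN_sum)
  with * show ?thesis
    by (simp add: wn_r_sum.abs_eq wn_iso_refl wn_h_count_abs WN_relabel_sum_encode WN_sum
        card_le_h_r_sum del: dposet_sel_relabel)
qed

text \<open>
  The extra term, compared with \<open>wn_r_sum\<close>, is what makes \<open>wn_h_sum P Q\<close> the leading term of
  \<open>P \<star> Q\<close>.
\<close>

lemma wn_h_count_h_sum [simp]:
  "wn_h_count (wn_h_sum a b) = wn_h_count a + wn_h_count b + wn_size a * wn_size b"
proof -
  obtain A B where *: "WN A" "a = abs_wnp A" "WN B" "b = abs_wnp B" by (meson wnp_cases)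
  let ?R = "relabel sum_encode (h_sum A B)"
  have "card (le_h ?R) = card (le_h (h_sum A B))"
    using * by (intro card_le_h_cong WN_double_poset WN_relabel_sum_encode
        dp_iso_relabel_sum_encode WN_sum)
  with * show ?thesis
    by (simp add: wn_h_sum.abs_eq wn_iso_refl wn_h_count_abs wn_size_abs WN_relabel_sum_encode
        WN_sum card_le_h_h_sum del: dposet_sel_relabel)
qed

lemma wn_size_empty [simp]: "wn_size wn_empty = 0"
  by (simp add: wn_empty_def wn_size_abs WN_small)

lemma wn_size_point [simp]: "wn_size wn_point = 1"
  by (simp add: wn_point_def wn_size_abs WN_small)

lemma wn_size_eq_0_iff: "wn_size x = 0 \<longleftrightarrow> x = wn_empty"
proof
  assume *: "wn_size x = 0"
  obtain P where P: "WN P" "x = abs_wnp P" by (rule wnp_cases)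
  then have "elems P = {}" using * WN_double_poset[OF P(1)] by (simp add: wn_size_abs double_poset_def)
  then have "dp_iso P (DPoset {} {} {})" by (simp add: dp_iso_def same_orders_def bij_betw_def)
  then show "x = wn_empty" using P by (simp add: wn_empty_def abs_wnp_eq_iff WN_small)
qed simp

lemma wn_size_eq_1_iff: "wn_size x = 1 \<longleftrightarrow> x = wn_point"
proof
  assume *: "wn_size x = 1"
  obtain P where P: "WN P" "x = abs_wnp P" by (rule wnp_cases)
  then obtain p where p: "elems P = {p}" using * by (auto simp: wn_size_abs card_1_singleton_iff)
  have pl: "plane_poset P" using P(1) by (simp add: WN_def)
  have "(p, p) \<in> le_h P" "(p, p) \<in> le_r P" using p plane_poset_rules(5,6)[OF pl] by auto
  then have "dp_iso P (DPoset {0} {(0, 0)} {(0, 0)})"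
    using p by (auto simp: dp_iso_def same_orders_def bij_betw_def intro!: exI[of _ "\<lambda>_. 0"])
  then show "x = wn_point" using P by (simp add: wn_point_def abs_wnp_eq_iff WN_small)
qed simp

lemma wn_swap_empty [simp]: "wn_swap wn_empty = wn_empty"
  by (simp flip: wn_size_eq_0_iff)

lemma wn_swap_point [simp]: "wn_swap wn_point = wn_point"
  by (simp flip: wn_size_eq_1_iff)

lemma r_sum_assoc_iso: "dp_iso (r_sum (r_sum A B) C) (r_sum A (r_sum B C))"
  unfolding dp_iso_def
proof (intro exI conjI)
  let ?f = "case_sum (case_sum Inl (Inr \<circ> Inl)) (Inr \<circ> Inr)"
  let ?g = "case_sum (Inl \<circ> Inl) (case_sum (Inl \<circ> Inr) Inr)"
  show "bij_betw ?f (elems (r_sum (r_sum A B) C)) (elems (r_sum A (r_sum B C)))"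
    by (rule bij_betw_byWitness[of _ ?g]) (auto simp: dposet_sel_sum)
  show "same_orders ?f (r_sum (r_sum A B) C) (r_sum A (r_sum B C))"
    by (auto simp: same_orders_def dposet_sel_sum)
qed

lemma wn_r_sum_assoc: "wn_r_sum (wn_r_sum a b) c = wn_r_sum a (wn_r_sum b c)"
proof -
  obtain A B C where W: "WN A" "WN B" "WN C" and e: "a = abs_wnp A" "b = abs_wnp B" "c = abs_wnp C"
    by (meson wnp_cases)
  let ?e = "relabel sum_encode"
  have WAB: "WN (r_sum A B)" "WN (r_sum B C)" using W by (auto intro: WN_sum)
  have 1: "dp_iso (r_sum (?e (r_sum A B)) C) (r_sum A (?e (r_sum B C)))"
    by (meson r_sum_assoc_iso dp_iso_sum dp_iso_relabel_sum_encode WAB dp_iso_refl dp_iso_sym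
        dp_iso_trans)
  have 2: "WN (r_sum (?e (r_sum A B)) C)" "WN (r_sum A (?e (r_sum B C)))"
    using W WAB by (auto intro!: WN_sum WN_relabel_sum_encode)
  have "dp_iso (?e (r_sum (?e (r_sum A B)) C)) (?e (r_sum A (?e (r_sum B C))))"
    by (meson 1 2 dp_iso_relabel_sum_encode dp_iso_sym dp_iso_trans)
  then show ?thesis
    using W WAB 2 by (simp add: e wn_r_sum.abs_eq wn_iso_refl WN_relabel_sum_encode abs_wnp_eq_iff)
qed

lemma wn_h_sum_assoc: "wn_h_sum (wn_h_sum a b) c = wn_h_sum a (wn_h_sum b c)"
  by (metis wn_r_sum_assoc wn_swap_h_sum wn_swap_swap)

section \<open>Unique factorisation of isomorphism classes\<close>

definition piece :: "nat dposet \<Rightarrow> nat set \<Rightarrow> wnp" where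
  "piece R S = abs_wnp (subposet R S)"

lemma wn_size_piece: "WN R \<Longrightarrow> S \<subseteq> elems R \<Longrightarrow> wn_size (piece R S) = card S"
  by (simp add: piece_def wn_size_abs WN_subposet)

lemma piece_subposet [simp]: "S \<subseteq> A \<Longrightarrow> piece (subposet R A) S = piece R S"
  by (simp add: piece_def)

lemma piece_all: "WN R \<Longrightarrow> piece R (elems R) = abs_wnp R"
  by (simp add: piece_def abs_wnp_eq_iff WN_subposet)
     (auto simp: dp_iso_def same_orders_def intro: exI[of _ id])

lemma piece_eq_iff:
  "WN R \<Longrightarrow> S \<subseteq> elems R \<Longrightarrow> WN P \<Longrightarrow> piece R S = abs_wnp P \<longleftrightarrow> dp_iso (subposet R S) P"
  by (simp add: piece_def abs_wnp_eq_iff WN_subposet)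

lemma piece_empty [simp]: "WN R \<Longrightarrow> piece R {} = wn_empty"
  by (simp add: wn_size_piece flip: wn_size_eq_0_iff)

lemma r_cut_sub: "r_cut R S \<Longrightarrow> S \<subseteq> elems R" and h_cut_sub: "h_cut R S \<Longrightarrow> S \<subseteq> elems R"
  by (auto simp: r_cut_def h_cut_def)

lemma r_sum_of_r_cut:
  assumes "WN R" "r_cut R S"
  shows "wn_r_sum (piece R S) (piece R (elems R - S)) = abs_wnp R"
  using assms r_cut_iso_r_sum[OF _ assms(2)] r_cut_sub[OF assms(2)]
  unfolding piece_def
  by (intro abs_eq_r_sum_iff[THEN iffD2, symmetric] WN_subposet) (auto simp: WN_def)

lemma h_sum_of_h_cut:
  assumes "WN R" "h_cut R S"
  shows "wn_h_sum (piece R S) (piece R (elems R - S)) = abs_wnp R"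
  using assms h_cut_iso_h_sum[OF _ assms(2)] h_cut_sub[OF assms(2)]
  unfolding piece_def
  by (intro abs_eq_h_sum_iff[THEN iffD2, symmetric] WN_subposet) (auto simp: WN_def)

lemma r_cut_of_r_sum:
  assumes "WN R" "abs_wnp R = wn_r_sum a b"
  obtains S where "r_cut R S" "piece R S = a" "piece R (elems R - S) = b"
proof -
  obtain A B where W: "WN A" "WN B" and e: "a = abs_wnp A" "b = abs_wnp B" by (meson wnp_cases)
  have "dp_iso R (r_sum A B)" using assms W by (simp add: e abs_eq_r_sum_iff)
  then obtain S where S: "r_cut R S" "dp_iso (subposet R S) A" "dp_iso (subposet R (elems R - S)) B"
    by (rule r_cut_of_iso_r_sum)
  then show ?thesis
    using that[of S] r_cut_sub[OF S(1)] by (simp add: e piece_eq_iff assms W)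
qed

lemma h_cut_of_h_sum:
  assumes "WN R" "abs_wnp R = wn_h_sum a b"
  obtains S where "h_cut R S" "piece R S = a" "piece R (elems R - S) = b"
proof -
  obtain A B where W: "WN A" "WN B" and e: "a = abs_wnp A" "b = abs_wnp B" by (meson wnp_cases)
  have "dp_iso R (h_sum A B)" using assms W by (simp add: e abs_eq_h_sum_iff)
  then obtain S where S: "h_cut R S" "dp_iso (subposet R S) A" "dp_iso (subposet R (elems R - S)) B"
    by (rule h_cut_of_iso_h_sum)
  then show ?thesis
    using that[of S] h_cut_sub[OF S(1)] by (simp add: e piece_eq_iff assms W)
qed

lemma wn_r_sum_empty [simp]: "wn_r_sum wn_empty x = x" "wn_r_sum x wn_empty = x"
proof -
  obtain R where R: "WN R" "x = abs_wnp R" by (rule wnp_cases)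
  have "r_cut R {}" "r_cut R (elems R)" by (auto simp: r_cut_def)
  from this[THEN r_sum_of_r_cut[OF R(1)]] show "wn_r_sum wn_empty x = x" "wn_r_sum x wn_empty = x"
    using R by (simp_all add: piece_all)
qed

lemma wn_h_sum_empty [simp]: "wn_h_sum wn_empty x = x" "wn_h_sum x wn_empty = x"
  by (metis wn_r_sum_empty wn_swap_empty wn_swap_h_sum wn_swap_swap)+

text \<open>
  Both decompositions are cuts of one representative, and cuts are nested; the common factor \<open>c\<close>
  is the class of the difference of the two cuts.
\<close>

lemma r_sum_refine:
  assumes "wn_r_sum a b = wn_r_sum a' b'" "wn_size a \<le> wn_size a'"
  obtains c where "a' = wn_r_sum a c" "b = wn_r_sum c b'"
proof -
  obtain R where R: "WN R" "wn_r_sum a b = abs_wnp R" by (rule wnp_cases)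
  have pl: "plane_poset R" using R(1) by (simp add: WN_def)
  obtain S where S: "r_cut R S" "piece R S = a" "piece R (elems R - S) = b"
    using r_cut_of_r_sum[OF R(1)] R(2) by metis
  obtain S' where S': "r_cut R S'" "piece R S' = a'" "piece R (elems R - S') = b'"
    using r_cut_of_r_sum[OF R(1)] R(2) assms(1) by metis
  have sub: "S \<subseteq> S'" "S' \<subseteq> elems R"
    using r_cut_subset[OF pl S(1) S'(1)] assms(2) S S' R(1)
    by (auto simp: wn_size_piece r_cut_sub dest: r_cut_sub)
  have "r_cut (subposet R S') S" using S(1) sub by (auto simp: r_cut_def)
  from r_sum_of_r_cut[OF _ this] have 1: "a' = wn_r_sum a (piece R (S' - S))"
    using S S' sub R(1) by (simp add: WN_subposet) (simp add: piece_def)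
  have "r_cut (subposet R (elems R - S)) (S' - S)" using S'(1) sub by (auto simp: r_cut_def)
  from r_sum_of_r_cut[OF WN_subposet[OF R(1)] this]
  have "wn_r_sum (piece R (S' - S)) (piece R (elems R - S - (S' - S))) = b"
    using S(3) sub(2) by (simp add: Diff_mono) (simp add: piece_def)
  moreover have "elems R - S - (S' - S) = elems R - S'" using sub by auto
  ultimately have "b = wn_r_sum (piece R (S' - S)) b'" using S' by simp
  with 1 show ?thesis by (rule that)
qed

lemma h_sum_refine:
  assumes "wn_h_sum a b = wn_h_sum a' b'" "wn_size a \<le> wn_size a'"
  obtains c where "a' = wn_h_sum a c" "b = wn_h_sum c b'"
proof -
  have "wn_r_sum (wn_swap a) (wn_swap b) = wn_r_sum (wn_swap a') (wn_swap b')"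
    using assms(1) by (simp flip: wn_swap_h_sum)
  then obtain c where "wn_swap a' = wn_r_sum (wn_swap a) c" "wn_swap b = wn_r_sum c (wn_swap b')"
    using assms(2) by (auto elim: r_sum_refine)
  then show ?thesis using that[of "wn_swap c"] by (metis wn_swap_r_sum wn_swap_swap)
qed

lemma r_sum_neq_h_sum:
  assumes "wn_size a > 0" "wn_size b > 0" "wn_size c > 0" "wn_size d > 0"
  shows "wn_r_sum a b \<noteq> wn_h_sum c d"
proof
  assume e: "wn_r_sum a b = wn_h_sum c d"
  obtain R where R: "WN R" "wn_r_sum a b = abs_wnp R" by (rule wnp_cases)
  obtain S where S: "r_cut R S" "piece R S = a" "piece R (elems R - S) = b"
    using r_cut_of_r_sum[OF R(1)] R(2) by metis
  obtain T where T: "h_cut R T" "piece R T = c" "piece R (elems R - T) = d"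
    using h_cut_of_h_sum[OF R(1)] R(2) e by metis
  have "S \<noteq> {}" "S \<noteq> elems R" "T \<noteq> {}" "T \<noteq> elems R" using assms S T R(1) by auto
  then show False using not_r_cut_and_h_cut[of R S T] R(1) S T by (simp add: WN_def)
qed

lemma wnp_decompose:
  assumes "wn_size x \<ge> 2"
  obtains a b where "wn_size a > 0" "wn_size b > 0" "x = wn_r_sum a b \<or> x = wn_h_sum a b"
proof -
  obtain R where R: "WN R" "x = abs_wnp R" by (rule wnp_cases)
  then obtain S where S: "S \<noteq> {}" "S \<noteq> elems R" "r_cut R S \<or> h_cut R S"
    using WN_ex_cut[of R] assms by (auto simp: wn_size_abs)
  have sub: "S \<subseteq> elems R" using S(3) by (auto simp: r_cut_def h_cut_def)
  have fin: "finite (elems R)" using WN_double_poset[OF R(1)] by (simp add: double_poset_def)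
  then have "finite S" using sub by (rule rev_finite_subset)
  then have "wn_size (piece R S) > 0" "wn_size (piece R (elems R - S)) > 0"
    using S sub R(1) fin by (auto simp: wn_size_piece card_gt_0_iff)
  then show ?thesis
    using that S(3) r_sum_of_r_cut[OF R(1), of S] h_sum_of_h_cut[OF R(1), of S] R(2) by metis
qed

lemma wnp_induct [case_names empty point r_sum h_sum]:
  assumes "P wn_empty" "P wn_point"
    and "\<And>a b. wn_size a > 0 \<Longrightarrow> wn_size b > 0 \<Longrightarrow> P a \<Longrightarrow> P b \<Longrightarrow> P (wn_r_sum a b)"
    and "\<And>a b. wn_size a > 0 \<Longrightarrow> wn_size b > 0 \<Longrightarrow> P a \<Longrightarrow> P b \<Longrightarrow> P (wn_h_sum a b)"
  shows "P x"
proof (induction "wn_size x" arbitrary: x rule: less_induct)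
  case less
  consider "wn_size x = 0" | "wn_size x = 1" | "wn_size x \<ge> 2" by linarith
  then show ?case
  proof cases
    case 3
    then obtain a b where ab: "wn_size a > 0" "wn_size b > 0" "x = wn_r_sum a b \<or> x = wn_h_sum a b"
      by (rule wnp_decompose)
    then have "wn_size a < wn_size x" "wn_size b < wn_size x" by auto
    then show ?thesis using ab assms(3,4) less by blast
  qed (use assms(1,2) in \<open>simp_all only: wn_size_eq_0_iff wn_size_eq_1_iff\<close>)
qed

text \<open>
  Evaluation of a class in a set with two operations, by decomposing it in any way. A class has
  many decompositions, so evaluation is first a relation; associativity makes it a function. Only
  nonempty factors are used, which keeps each step decreasing in size.
\<close>

inductive wn_eval ::
  "('b \<Rightarrow> 'b \<Rightarrow> 'b) \<Rightarrow> ('b \<Rightarrow> 'b \<Rightarrow> 'b) \<Rightarrow> 'b \<Rightarrow> 'b \<Rightarrow> wnp \<Rightarrow> 'b \<Rightarrow> bool"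
  for dot ast :: "'b \<Rightarrow> 'b \<Rightarrow> 'b" and one y :: 'b where
  wn_eval_empty: "wn_eval dot ast one y wn_empty one"
| wn_eval_point: "wn_eval dot ast one y wn_point y"
| wn_eval_r_sum: "wn_size a > 0 \<Longrightarrow> wn_size b > 0 \<Longrightarrow> wn_eval dot ast one y a u \<Longrightarrow>
    wn_eval dot ast one y b v \<Longrightarrow> wn_eval dot ast one y (wn_r_sum a b) (dot u v)"
| wn_eval_h_sum: "wn_size a > 0 \<Longrightarrow> wn_size b > 0 \<Longrightarrow> wn_eval dot ast one y a u \<Longrightarrow>
    wn_eval dot ast one y b v \<Longrightarrow> wn_eval dot ast one y (wn_h_sum a b) (ast u v)"

lemma wn_eval_total: "\<exists>u. wn_eval dot ast one y x u"
  by (induction x rule: wnp_induct) (blast intro: wn_eval.intros)+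

text \<open>
  The common core of the two sums: refine the two decompositions to a common one with three
  factors \<open>a\<close>, \<open>c\<close>, \<open>b'\<close>; the two values are then the two bracketings of one product. The
  assumptions on \<open>m\<close> are shared by \<open>wn_r_sum\<close> and \<open>wn_h_sum\<close>, and \<open>unique\<close> is the induction
  hypothesis.
\<close>

lemma wn_eval_step_unique:
  fixes E :: "wnp \<Rightarrow> 'b \<Rightarrow> bool"
  assumes refine: "\<And>a b a' b'. m a b = m a' b' \<Longrightarrow> wn_size a \<le> wn_size a' \<Longrightarrow>
        \<exists>c. a' = m a c \<and> b = m c b'"
    and size: "\<And>a b. wn_size (m a b) = wn_size a + wn_size b"
    and unit: "\<And>a. m a wn_empty = a" "\<And>a. m wn_empty a = a"
    and assoc: "\<And>u v w. dot (dot u v) w = dot u (dot v w)"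
    and total: "\<And>a. \<exists>u. E a u"
    and step: "\<And>a b u v. wn_size a > 0 \<Longrightarrow> wn_size b > 0 \<Longrightarrow> E a u \<Longrightarrow> E b v \<Longrightarrow> E (m a b) (dot u v)"
    and unique: "\<And>z u v. wn_size z < wn_size (m a b) \<Longrightarrow> E z u \<Longrightarrow> E z v \<Longrightarrow> u = v"
    and eq: "m a b = m a' b'"
    and pos: "wn_size a > 0" "wn_size b > 0" "wn_size a' > 0" "wn_size b' > 0"
    and E: "E a u" "E b v" "E a' u'" "E b' v'"
  shows "dot u v = dot u' v'"
proof -
  have sizes: "wn_size a < wn_size (m a b)" "wn_size b < wn_size (m a b)"
    "wn_size a' < wn_size (m a b)" "wn_size b' < wn_size (m a b)"
    using pos size[of a b] size[of a' b'] eq by auto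
  have le: "dot p q = dot p' q'"
    if A: "m c d = m c' d'" "m c d = m a b" "wn_size c \<le> wn_size c'" "wn_size c > 0" "wn_size d > 0"
      "wn_size c' > 0" "wn_size d' > 0" "E c p" "E d q" "E c' p'" "E d' q'" for c d c' d' p q p' q'
  proof -
    have sz: "wn_size c < wn_size (m a b)" "wn_size d < wn_size (m a b)"
      "wn_size c' < wn_size (m a b)" "wn_size d' < wn_size (m a b)"
      using A(2,4-7) size[of c d] size[of c' d'] A(1) by auto
    obtain e where e: "c' = m c e" "d = m e d'" using refine[OF A(1,3)] by blast
    show ?thesis
    proof (cases "wn_size e = 0")
      case True
      then have "c' = c" "d' = d" using e unit by (auto simp: wn_size_eq_0_iff)
      then show ?thesis using unique A sz by metis
    next
      case False
      obtain w where w: "E e w" using total by blast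
      have "E c' (dot p w)" "E d (dot w q')" using step e w A False by auto
      then have "p' = dot p w" "q = dot w q'" using unique A sz by blast+
      then show ?thesis using assoc by simp
    qed
  qed
  show ?thesis
  proof (cases "wn_size a \<le> wn_size a'")
    case True
    then show ?thesis using le[OF eq] pos E by blast
  next
    case False
    then show ?thesis using le[OF eq[symmetric] eq[symmetric]] pos E by (metis nat_le_linear)
  qed
qed

lemma wn_eval_r_sumE:
  assumes "wn_eval dot ast one y x w" "x = wn_r_sum a b" "wn_size a > 0" "wn_size b > 0"
  obtains a' b' u v where "x = wn_r_sum a' b'" "w = dot u v" "wn_size a' > 0" "wn_size b' > 0"
    "wn_eval dot ast one y a' u" "wn_eval dot ast one y b' v"
proof -
  have size: "wn_size x \<ge> 2" using assms(2-4) by simp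
  show ?thesis
    using assms(1)
  proof cases
    case wn_eval_empty
    then show ?thesis using size by simp
  next
    case wn_eval_point
    then show ?thesis using size by simp
  next
    case (wn_eval_r_sum a' b' u v)
    then show ?thesis using that by blast
  next
    case (wn_eval_h_sum a' b' u v)
    then show ?thesis using r_sum_neq_h_sum[OF assms(3,4)] assms(2) by metis
  qed
qed

lemma wn_eval_h_sumE:
  assumes "wn_eval dot ast one y x w" "x = wn_h_sum a b" "wn_size a > 0" "wn_size b > 0"
  obtains a' b' u v where "x = wn_h_sum a' b'" "w = ast u v" "wn_size a' > 0" "wn_size b' > 0"
    "wn_eval dot ast one y a' u" "wn_eval dot ast one y b' v"
proof -
  have size: "wn_size x \<ge> 2" using assms(2-4) by simp
  show ?thesis
    using assms(1)
  proof cases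
    case wn_eval_empty
    then show ?thesis using size by simp
  next
    case wn_eval_point
    then show ?thesis using size by simp
  next
    case (wn_eval_r_sum a' b' u v)
    then show ?thesis using r_sum_neq_h_sum[OF _ _ assms(3,4)] assms(2) by metis
  next
    case (wn_eval_h_sum a' b' u v)
    then show ?thesis using that by blast
  qed
qed

text \<open>
  Two evaluations of the same class end with the same kind of sum, by \<open>r_sum_neq_h_sum\<close>, so that
  \<open>wn_eval_step_unique\<close> compares them.
\<close>

lemma wn_eval_unique:
  assumes assoc: "\<And>u v w. dot (dot u v) w = dot u (dot v w)" "\<And>u v w. ast (ast u v) w = ast u (ast v w)"
    and "wn_eval dot ast one y x u" "wn_eval dot ast one y x v"
  shows "u = v"
  using assms(3,4)
proof (induction "wn_size x" arbitrary: x u v rule: less_induct)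
  case less
  let ?E = "wn_eval dot ast one y"
  note total = wn_eval_total[of dot ast one y]
  show ?case
    using less.prems(1)
  proof cases
    case wn_eval_empty
    show ?thesis using less.prems(2) wn_eval_empty
      by cases (auto simp flip: wn_size_eq_0_iff wn_size_eq_1_iff)
  next
    case wn_eval_point
    show ?thesis using less.prems(2) wn_eval_point
      by cases (auto simp flip: wn_size_eq_0_iff wn_size_eq_1_iff)
  next
    case (wn_eval_r_sum a b p q)
    from less.prems(2) wn_eval_r_sum(1,3,4) obtain a' b' p' q' where *:
      "x = wn_r_sum a' b'" "v = dot p' q'" "wn_size a' > 0" "wn_size b' > 0" "?E a' p'" "?E b' q'"
      by (blast elim: wn_eval_r_sumE)
    have "dot p q = dot p' q'"
    proof (rule wn_eval_step_unique[where E = ?E and m = wn_r_sum and dot = dot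
          and a = a and b = b and a' = a' and b' = b' and u = p and v = q and u' = p' and v' = q'])
      show "\<exists>c. f = wn_r_sum d c \<and> e = wn_r_sum c g"
        if "wn_r_sum d e = wn_r_sum f g" "wn_size d \<le> wn_size f" for d e f g
        using r_sum_refine[OF that] by metis
      show "?E (wn_r_sum d e) (dot u v)"
        if "wn_size d > 0" "wn_size e > 0" "?E d u" "?E e v" for d e u v
        using that by (rule wn_eval.wn_eval_r_sum)
      show "u = v" if "wn_size z < wn_size (wn_r_sum a b)" "?E z u" "?E z v" for z u v
        using less.hyps[of z u v] that wn_eval_r_sum(1) by simp
    qed (use * wn_eval_r_sum total in \<open>simp_all add: assoc\<close>)
    then show ?thesis using * wn_eval_r_sum by simp
  next
    case (wn_eval_h_sum a b p q)
    from less.prems(2) wn_eval_h_sum(1,3,4) obtain a' b' p' q' where *: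
      "x = wn_h_sum a' b'" "v = ast p' q'" "wn_size a' > 0" "wn_size b' > 0" "?E a' p'" "?E b' q'"
      by (blast elim: wn_eval_h_sumE)
    have "ast p q = ast p' q'"
    proof (rule wn_eval_step_unique[where E = ?E and m = wn_h_sum and dot = ast
          and a = a and b = b and a' = a' and b' = b' and u = p and v = q and u' = p' and v' = q'])
      show "\<exists>c. f = wn_h_sum d c \<and> e = wn_h_sum c g"
        if "wn_h_sum d e = wn_h_sum f g" "wn_size d \<le> wn_size f" for d e f g
        using h_sum_refine[OF that] by metis
      show "?E (wn_h_sum d e) (ast u v)"
        if "wn_size d > 0" "wn_size e > 0" "?E d u" "?E e v" for d e u v
        using that by (rule wn_eval.wn_eval_h_sum)
      show "u = v" if "wn_size z < wn_size (wn_h_sum a b)" "?E z u" "?E z v" for z u v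
        using less.hyps[of z u v] that wn_eval_h_sum(1) by simp
    qed (use * wn_eval_h_sum total in \<open>simp_all add: assoc\<close>)
    then show ?thesis using * wn_eval_h_sum by simp
  qed
qed

text \<open>
  The existence half of freeness on the generator \<open>wn_point\<close>; uniqueness is an instance of
  \<open>wnp_induct\<close>. Empty factors, which \<open>wn_eval\<close> leaves out, are dealt with by the unit laws.
\<close>

lemma wnp_universal:
  assumes assoc: "\<And>u v w. dot (dot u v) w = dot u (dot v w)" "\<And>u v w. ast (ast u v) w = ast u (ast v w)"
    and unit: "\<And>u. dot one u = u" "\<And>u. dot u one = u" "\<And>u. ast one u = u" "\<And>u. ast u one = u"
  obtains F where "F wn_empty = one" "F wn_point = y"
    "\<And>a b. F (wn_r_sum a b) = dot (F a) (F b)" "\<And>a b. F (wn_h_sum a b) = ast (F a) (F b)"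
proof -
  define F where "F x = (THE u. wn_eval dot ast one y x u)" for x
  have F: "F x = u" if "wn_eval dot ast one y x u" for x u
    unfolding F_def
  proof (rule the_equality)
    show "v = u" if "wn_eval dot ast one y x v" for v
      using wn_eval_unique[OF assoc that \<open>wn_eval dot ast one y x u\<close>] .
  qed (rule that)
  have E: "wn_eval dot ast one y x (F x)" for x
    using wn_eval_total[of dot ast one y x] F by auto
  have e: "F wn_empty = one" "F wn_point = y" by (auto intro: F wn_eval.intros)
  have "F (wn_r_sum a b) = dot (F a) (F b)" "F (wn_h_sum a b) = ast (F a) (F b)" for a b
  proof -
    consider "a = wn_empty" | "b = wn_empty" | "wn_size a > 0" "wn_size b > 0"
      using wn_size_eq_0_iff by blast
    then have "F (wn_r_sum a b) = dot (F a) (F b) \<and> F (wn_h_sum a b) = ast (F a) (F b)"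
      by cases (auto simp: e unit intro: F wn_eval.intros E)
    then show "F (wn_r_sum a b) = dot (F a) (F b)" "F (wn_h_sum a b) = ast (F a) (F b)" by auto
  qed
  with e show ?thesis by (rule that)
qed

section \<open>Linear and bilinear maps on the space of WN posets\<close>

lemma lookup_h_scale [simp]:
  "Poly_Mapping.lookup (h_scale c x) P = c * Poly_Mapping.lookup x P"
  by (simp add: h_scale_def Poly_Mapping.map.rep_eq when_def)

lemma vector_space_h_scale: "vector_space (h_scale :: 'k::field \<Rightarrow> 'k hwnp \<Rightarrow> 'k hwnp)"
  by unfold_locales (rule poly_mapping_eqI; simp add: lookup_add algebra_simps)+

lemma lookup_basis: "Poly_Mapping.lookup (basis P :: 'k::field hwnp) R = (if R = P then 1 else 0)"
  by (simp add: basis_def lookup_single when_def)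

lemma keys_basis [simp]: "Poly_Mapping.keys (basis P :: 'k::field hwnp) = {P}"
  by (simp add: basis_def)

definition lin_ext ::
  "('k::field \<Rightarrow> 'b::ab_group_add \<Rightarrow> 'b) \<Rightarrow> (wnp \<Rightarrow> 'b) \<Rightarrow> 'k hwnp \<Rightarrow> 'b" where
  "lin_ext scale F x = (\<Sum>P\<in>Poly_Mapping.keys x. scale (Poly_Mapping.lookup x P) (F P))"

lemma lin_ext_superset:
  assumes "vector_space scale" "finite A" "Poly_Mapping.keys x \<subseteq> A"
  shows "lin_ext scale F x = (\<Sum>P\<in>A. scale (Poly_Mapping.lookup x P) (F P))"
proof -
  interpret vector_space scale by fact
  show ?thesis
    unfolding lin_ext_def using assms(2,3)
    by (intro sum.mono_neutral_left) (auto simp: in_keys_iff)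
qed

lemma linear_lin_ext:
  fixes scale :: "'k::field \<Rightarrow> 'b::ab_group_add \<Rightarrow> 'b"
  assumes "vector_space scale"
  shows "Vector_Spaces.linear h_scale scale (lin_ext scale F)"
proof -
  interpret vector_space scale by fact
  have "lin_ext scale F (x + y) = lin_ext scale F x + lin_ext scale F y" for x y
  proof -
    let ?A = "Poly_Mapping.keys x \<union> Poly_Mapping.keys y"
    have fin: "finite ?A" by simp
    note s = lin_ext_superset[OF assms fin, of _ F]
    have "lin_ext scale F (x + y) =
        (\<Sum>P\<in>?A. scale (Poly_Mapping.lookup x P + Poly_Mapping.lookup y P) (F P))"
      by (subst s) (simp_all add: lookup_add keys_add)
    also have "\<dots> = lin_ext scale F x + lin_ext scale F y"
      by (simp add: s scale_left_distrib sum.distrib)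
    finally show ?thesis .
  qed
  moreover have "lin_ext scale F (h_scale c x) = scale c (lin_ext scale F x)" for c x
  proof -
    have "Poly_Mapping.keys (h_scale c x) \<subseteq> Poly_Mapping.keys x" by (auto simp: in_keys_iff)
    then have "lin_ext scale F (h_scale c x) =
        (\<Sum>P\<in>Poly_Mapping.keys x. scale (c * Poly_Mapping.lookup x P) (F P))"
      by (subst lin_ext_superset[OF assms, of "Poly_Mapping.keys x"]) simp_all
    also have "\<dots> = scale c (lin_ext scale F x)"
      by (simp add: lin_ext_def scale_sum_right)
    finally show ?thesis .
  qed
  ultimately show ?thesis by (simp add: Vector_Spaces.linear_iff assms vector_space_h_scale)
qed

lemma lin_ext_basis:
  assumes "vector_space scale"
  shows "lin_ext scale F (basis P) = F P"
proof -
  interpret vector_space scale by fact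
  show ?thesis by (simp add: lin_ext_def lookup_basis)
qed

lemma hwnp_expand:
  "x = (\<Sum>P\<in>Poly_Mapping.keys x. h_scale (Poly_Mapping.lookup x P) (basis P))"
  by (rule poly_mapping_eqI) (simp add: lookup_sum lookup_basis in_keys_iff if_distrib sum.delta cong: if_cong)

lemma linear_expand:
  assumes "Vector_Spaces.linear h_scale scale f"
  shows "f x = (\<Sum>P\<in>Poly_Mapping.keys x. scale (Poly_Mapping.lookup x P) (f (basis P)))"
proof -
  interpret Vector_Spaces.linear h_scale scale f by fact
  show ?thesis by (subst hwnp_expand[of x]) (simp add: sum scale)
qed

lemma linear_eq_on_basis:
  assumes "Vector_Spaces.linear h_scale scale f" "Vector_Spaces.linear h_scale scale g"
    and "\<And>P. f (basis P) = g (basis P)"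
  shows "f x = g x"
  unfolding linear_expand[OF assms(1), of x] linear_expand[OF assms(2), of x]
  by (simp only: assms(3))

lemma bilinear_eq_on_basis:
  assumes "\<And>y. Vector_Spaces.linear h_scale scale (\<lambda>x. f x y)" "\<And>x. Vector_Spaces.linear h_scale scale (f x)"
    and "\<And>y. Vector_Spaces.linear h_scale scale (\<lambda>x. g x y)" "\<And>x. Vector_Spaces.linear h_scale scale (g x)"
    and "\<And>P Q. f (basis P) (basis Q) = g (basis P) (basis Q)"
  shows "f x y = g x y"
proof (rule linear_eq_on_basis[OF assms(1) assms(3)])
  show "f (basis P) y = g (basis P) y" for P
    by (rule linear_eq_on_basis[OF assms(2) assms(4) assms(5)])
qed

lemma bilinear_ext_eq_left:
  "bilinear_ext b x y = lin_ext h_scale (\<lambda>P. lin_ext h_scale (b P) y) x"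
proof -
  interpret vector_space h_scale by (rule vector_space_h_scale)
  show ?thesis by (simp add: bilinear_ext_def lin_ext_def scale_sum_right)
qed

lemma bilinear_ext_eq_right:
  "bilinear_ext b x y = lin_ext h_scale (\<lambda>Q. lin_ext h_scale (\<lambda>P. b P Q) x) y"
proof -
  interpret vector_space h_scale by (rule vector_space_h_scale)
  show ?thesis
    unfolding bilinear_ext_def lin_ext_def
    by (subst sum.swap) (simp add: scale_sum_right mult.commute)
qed

lemma linear_bilinear_ext:
  "Vector_Spaces.linear h_scale h_scale (\<lambda>x. bilinear_ext b x y)"
  "Vector_Spaces.linear h_scale h_scale (bilinear_ext b x)"
proof -
  show "Vector_Spaces.linear h_scale h_scale (\<lambda>x. bilinear_ext b x y)"
    unfolding bilinear_ext_eq_left by (rule linear_lin_ext[OF vector_space_h_scale])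
  have "bilinear_ext b x = lin_ext h_scale (\<lambda>Q. lin_ext h_scale (\<lambda>P. b P Q) x)"
    by (rule ext) (rule bilinear_ext_eq_right)
  then show "Vector_Spaces.linear h_scale h_scale (bilinear_ext b x)"
    by (simp add: linear_lin_ext[OF vector_space_h_scale])
qed

lemma bilinear_ext_basis: "bilinear_ext b (basis P) (basis Q) = b P Q"
  by (simp add: bilinear_ext_eq_left lin_ext_basis vector_space_h_scale)

lemma unital_assoc_algebra_bilinear_ext:
  fixes b :: "wnp \<Rightarrow> wnp \<Rightarrow> 'k::field hwnp"
  assumes "\<And>x y z. bilinear_ext b (bilinear_ext b x y) z = bilinear_ext b x (bilinear_ext b y z)"
    and "\<And>x. bilinear_ext b e x = x" "\<And>x. bilinear_ext b x e = x"
  shows "unital_assoc_algebra h_scale (bilinear_ext b) e"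
proof -
  interpret vector_space "h_scale :: 'k \<Rightarrow> 'k hwnp \<Rightarrow> 'k hwnp" by (rule vector_space_h_scale)
  note l = linear_bilinear_ext(1)[of b, unfolded Vector_Spaces.linear_iff]
  note r = linear_bilinear_ext(2)[of b, unfolded Vector_Spaces.linear_iff]
  show ?thesis
    by unfold_locales (use l r assms in blast)+
qed

lemma linear_compose_hwnp:
  assumes "Vector_Spaces.linear h_scale h_scale f" "Vector_Spaces.linear h_scale s g"
  shows "Vector_Spaces.linear h_scale s (\<lambda>x. g (f x))"
  using assms by (simp add: Vector_Spaces.linear_iff)

lemma linear_id_hwnp: "Vector_Spaces.linear h_scale h_scale (\<lambda>x. x)"
  by (simp add: Vector_Spaces.linear_iff vector_space_h_scale)

text \<open>
  The algebra of a monoid: trilinearity reduces associativity to basis elements.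
\<close>

lemma unital_assoc_algebra_monoid:
  fixes m :: "wnp \<Rightarrow> wnp \<Rightarrow> wnp"
  assumes assoc: "\<And>a b c. m (m a b) c = m a (m b c)" and unit: "\<And>a. m e a = a" "\<And>a. m a e = a"
  shows "unital_assoc_algebra h_scale (bilinear_ext (\<lambda>P Q. basis (m P Q) :: 'k::field hwnp)) (basis e)"
proof (rule unital_assoc_algebra_bilinear_ext)
  let ?B = "bilinear_ext (\<lambda>P Q. basis (m P Q) :: 'k hwnp)"
  note l = linear_bilinear_ext(1)[of "\<lambda>P Q. basis (m P Q) :: 'k hwnp"]
  note r = linear_bilinear_ext(2)[of "\<lambda>P Q. basis (m P Q) :: 'k hwnp"]
  show "?B (?B x y) z = ?B x (?B y z)" for x y z
  proof (rule linear_eq_on_basis[OF linear_compose_hwnp[OF l l] l])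
    fix P
    show "?B (?B (basis P) y) z = ?B (basis P) (?B y z)"
    proof (rule bilinear_eq_on_basis[of _ "\<lambda>y z. ?B (?B (basis P) y) z" "\<lambda>y z. ?B (basis P) (?B y z)"])
      show "Vector_Spaces.linear h_scale h_scale (\<lambda>x. ?B (?B (basis P) x) y)" for y
        by (rule linear_compose_hwnp[OF r l])
      show "Vector_Spaces.linear h_scale h_scale (?B (?B (basis P) x))" for x
        by (rule r)
      show "Vector_Spaces.linear h_scale h_scale (\<lambda>x. ?B (basis P) (?B x y))" for y
        by (rule linear_compose_hwnp[OF l r])
      show "Vector_Spaces.linear h_scale h_scale (\<lambda>y. ?B (basis P) (?B x y))" for x
        by (rule linear_compose_hwnp[OF r r])
    qed (simp add: bilinear_ext_basis assoc)
  qed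
  show "?B (basis e) x = x" "?B x (basis e) = x" for x
    by (rule linear_eq_on_basis[OF r linear_id_hwnp]; simp add: bilinear_ext_basis unit)
       (rule linear_eq_on_basis[OF l linear_id_hwnp]; simp add: bilinear_ext_basis unit)
qed

lemma lookup_bilinear_ext:
  "Poly_Mapping.lookup (bilinear_ext b x y) R =
    (\<Sum>P\<in>Poly_Mapping.keys x. \<Sum>Q\<in>Poly_Mapping.keys y.
       Poly_Mapping.lookup x P * Poly_Mapping.lookup y Q * Poly_Mapping.lookup (b P Q) R)"
  by (simp add: bilinear_ext_def lookup_sum)

section \<open>The product counting ideals\<close>

definition ideals :: "'a dposet \<Rightarrow> 'a set set" where
  "ideals T = {I. ideal T I}"

lemma finite_ideals: "WN T \<Longrightarrow> finite (ideals T)"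
  by (rule finite_subset[of _ "Pow (elems T)"])
     (auto simp: ideals_def ideal_def dest: WN_double_poset simp: double_poset_def)

lemma wn_cuts_abs:
  assumes "WN T"
  shows "wn_cuts P Q (abs_wnp T) =
    card {I \<in> ideals T. piece T (elems T - I) = P \<and> piece T I = Q}"
proof -
  obtain p q where *: "WN p" "P = abs_wnp p" "WN q" "Q = abs_wnp q" by (meson wnp_cases)
  then have "wn_cuts P Q (abs_wnp T) = card (cut_ideals p q T)"
    using assms by (simp add: wn_cuts.abs_eq wn_iso_refl)
  also have "cut_ideals p q T = {I \<in> ideals T. piece T (elems T - I) = P \<and> piece T I = Q}"
    using assms * by (auto simp: cut_ideals_def ideals_def ideal_def piece_eq_iff)
  finally show ?thesis .
qed

lemma lookup_star_coeffs:
  "Poly_Mapping.lookup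
     (\<Sum>R | wn_cuts P Q R \<noteq> 0. h_scale (of_nat (wn_cuts P Q R)) (basis R :: 'k::field hwnp)) T
   = of_nat (wn_cuts P Q T)"
  by (simp add: lookup_sum lookup_basis if_distrib finite_wn_cuts[of P Q, unfolded neq0_conv]
      cong: if_cong)

text \<open>
  Elements of the space are viewed as functions on isomorphism classes. The product is then the
  convolution over the ideals of a representative, because summing over the isomorphism types of
  an ideal and of its complement is the same as summing over the ideals.
\<close>

lemma lookup_h_star:
  fixes x y :: "'k::field hwnp"
  assumes "WN T"
  shows "Poly_Mapping.lookup (h_star x y) (abs_wnp T) =
    (\<Sum>I\<in>ideals T. Poly_Mapping.lookup x (piece T (elems T - I)) * Poly_Mapping.lookup y (piece T I))"
proof -
  let ?x = "Poly_Mapping.lookup x" and ?y = "Poly_Mapping.lookup y"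
  let ?a = "\<lambda>I. piece T (elems T - I)" and ?b = "piece T"
  have fin: "finite (ideals T)" by (rule finite_ideals[OF assms])
  have "Poly_Mapping.lookup (h_star x y) (abs_wnp T) =
    (\<Sum>P\<in>Poly_Mapping.keys x. \<Sum>Q\<in>Poly_Mapping.keys y. \<Sum>I\<in>ideals T.
       (if ?a I = P then ?x P else 0) * (if ?b I = Q then ?y Q else 0))"
    unfolding h_star_def lookup_bilinear_ext lookup_star_coeffs wn_cuts_abs[OF assms]
  proof (intro sum.cong refl)
    fix P Q
    have "(\<Sum>I\<in>ideals T. (if ?a I = P then ?x P else 0) * (if ?b I = Q then ?y Q else 0))
        = (\<Sum>I\<in>ideals T. if ?a I = P \<and> ?b I = Q then ?x P * ?y Q else 0)"
      by (intro sum.cong refl) simp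
    also have "\<dots> = (\<Sum>I\<in>{I \<in> ideals T. ?a I = P \<and> ?b I = Q}. ?x P * ?y Q)"
      by (rule sum.inter_filter[OF fin, symmetric])
    finally show "?x P * ?y Q * of_nat (card {I \<in> ideals T. ?a I = P \<and> ?b I = Q}) =
      (\<Sum>I\<in>ideals T. (if ?a I = P then ?x P else 0) * (if ?b I = Q then ?y Q else 0))"
      by (simp add: mult.commute)
  qed
  also have "\<dots> = (\<Sum>P\<in>Poly_Mapping.keys x. \<Sum>I\<in>ideals T. \<Sum>Q\<in>Poly_Mapping.keys y.
       (if ?a I = P then ?x P else 0) * (if ?b I = Q then ?y Q else 0))"
    by (intro sum.cong refl sum.swap)
  also have "\<dots> = (\<Sum>I\<in>ideals T. \<Sum>P\<in>Poly_Mapping.keys x. \<Sum>Q\<in>Poly_Mapping.keys y.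
       (if ?a I = P then ?x P else 0) * (if ?b I = Q then ?y Q else 0))"
    by (rule sum.swap)
  also have "\<dots> = (\<Sum>I\<in>ideals T. ?x (?a I) * ?y (?b I))"
    by (intro sum.cong refl)
       (simp flip: sum_product add: in_keys_iff)
  finally show ?thesis .
qed

text \<open>
  Cutting \<open>T\<close> into three consecutive pieces: first the top piece \<open>I\<close> and then \<open>K\<close>, or first the
  two upper pieces \<open>J = I \<union> K\<close> together and then \<open>I\<close>.
\<close>

lemma ideals_nested:
  assumes "WN T"
  shows "(\<lambda>(I, K). (I \<union> K, I)) ` (SIGMA I:ideals T. ideals (subposet T (elems T - I)))
      = (SIGMA J:ideals T. ideals (subposet T J))" (is "?f ` ?A = ?B")
proof
  show "?f ` ?A \<subseteq> ?B"
  proof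
    fix q assume "q \<in> ?f ` ?A"
    then obtain I K where q: "q = (I \<union> K, I)" and I: "ideal T I"
      and K: "ideal (subposet T (elems T - I)) K"
      by (auto simp: ideals_def)
    have sub: "I \<subseteq> elems T" "K \<subseteq> elems T - I" using I K by (auto simp: ideal_def)
    have "y \<in> I \<union> K" if "x \<in> I \<union> K" "y \<in> elems T" "(x, y) \<in> le_h T" for x y
      using that I K sub(2) unfolding ideal_def dposet_sel_subposet by blast
    then have "ideal T (I \<union> K)" using sub unfolding ideal_def by blast
    moreover have "ideal (subposet T (I \<union> K)) I" using I sub by (auto simp: ideal_def)
    ultimately show "q \<in> ?B" by (simp add: q ideals_def)
  qed
  show "?B \<subseteq> ?f ` ?A"
  proof
    fix q assume "q \<in> ?B"
    then obtain J I where q: "q = (J, I)" and J: "ideal T J" and I: "ideal (subposet T J) I"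
      by (auto simp: ideals_def)
    have "I \<subseteq> J" "J \<subseteq> elems T" using I J by (auto simp: ideal_def)
    moreover have "ideal T I" using I J by (auto simp: ideal_def)
    moreover have "ideal (subposet T (elems T - I)) (J - I)" using J by (auto simp: ideal_def)
    moreover have "I \<union> (J - I) = J" using \<open>I \<subseteq> J\<close> by blast
    ultimately show "q \<in> ?f ` ?A"
      unfolding q by (intro image_eqI[of _ _ "(I, J - I)"]) (auto simp: ideals_def)
  qed
qed

text \<open>
  Both bracketings are the sum, over all ways to cut \<open>T\<close> into three consecutive pieces, of the
  product of the three values.
\<close>

lemma h_star_assoc:
  fixes x y z :: "'k::field hwnp"
  shows "h_star (h_star x y) z = h_star x (h_star y z)"
proof (rule poly_mapping_eqI)
  fix t
  obtain T where T: "WN T" "t = abs_wnp T" by (rule wnp_cases)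
  let ?x = "Poly_Mapping.lookup x" and ?y = "Poly_Mapping.lookup y" and ?z = "Poly_Mapping.lookup z"
  let ?A = "SIGMA I:ideals T. ideals (subposet T (elems T - I))"
  let ?B = "SIGMA J:ideals T. ideals (subposet T J)"
  have sub: "I \<subseteq> elems T" if "I \<in> ideals T" for I using that by (auto simp: ideals_def ideal_def)
  have W: "WN (subposet T I)" if "I \<subseteq> elems T" for I using WN_subposet[OF T(1) that] .
  have fin: "finite (ideals (subposet T I))" if "I \<subseteq> elems T" for I
    using finite_ideals[OF W[OF that]] .
  have sub2: "K \<subseteq> A" if "K \<in> ideals (subposet T A)" for K A
    using that by (auto simp: ideals_def ideal_def)
  have "Poly_Mapping.lookup (h_star (h_star x y) z) t =
      (\<Sum>I\<in>ideals T. \<Sum>K\<in>ideals (subposet T (elems T - I)).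
         ?x (piece T (elems T - I - K)) * ?y (piece T K) * ?z (piece T I))"
    unfolding T(2) lookup_h_star[OF T(1)]
  proof (intro sum.cong refl)
    fix I assume "I \<in> ideals T"
    have "Poly_Mapping.lookup (h_star x y) (piece T (elems T - I)) =
      (\<Sum>K\<in>ideals (subposet T (elems T - I)). ?x (piece T (elems T - I - K)) * ?y (piece T K))"
      unfolding piece_def[of T "elems T - I"] lookup_h_star[OF W[OF Diff_subset]]
      by (intro sum.cong refl) (simp add: sub2)
    then show "Poly_Mapping.lookup (h_star x y) (piece T (elems T - I)) * ?z (piece T I) =
      (\<Sum>K\<in>ideals (subposet T (elems T - I)).
         ?x (piece T (elems T - I - K)) * ?y (piece T K) * ?z (piece T I))"
      by (simp add: sum_distrib_right)
  qed
  also have "\<dots> = (\<Sum>(I, K)\<in>?A. ?x (piece T (elems T - I - K)) * ?y (piece T K) * ?z (piece T I))"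
    using fin by (intro sum.Sigma finite_ideals T(1)) auto
  also have "\<dots> = (\<Sum>(J, I)\<in>(\<lambda>(I, K). (I \<union> K, I)) ` ?A.
      ?x (piece T (elems T - J)) * (?y (piece T (J - I)) * ?z (piece T I)))"
  proof (subst sum.reindex)
    have disj: "I \<inter> K = {}" if "K \<in> ideals (subposet T (elems T - I))" for I K
      using sub2[OF that] by blast
    show "inj_on (\<lambda>(I, K). (I \<union> K, I)) ?A"
    proof (rule inj_onI)
      fix p q assume pq: "p \<in> ?A" "q \<in> ?A" "(\<lambda>(I, K). (I \<union> K, I)) p = (\<lambda>(I, K). (I \<union> K, I)) q"
      obtain I K I' K' where e: "p = (I, K)" "q = (I', K')" by (metis surj_pair)
      have "I = I'" "I \<union> K = I' \<union> K'" "I \<inter> K = {}" "I' \<inter> K' = {}" using pq disj by (auto simp: e)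
      then show "p = q" unfolding e by blast
    qed
    show "(\<Sum>(I, K)\<in>?A. ?x (piece T (elems T - I - K)) * ?y (piece T K) * ?z (piece T I)) =
      sum ((\<lambda>(J, I). ?x (piece T (elems T - J)) * (?y (piece T (J - I)) * ?z (piece T I)))
        \<circ> (\<lambda>(I, K). (I \<union> K, I))) ?A"
    proof (intro sum.cong refl)
      fix p assume p: "p \<in> ?A"
      obtain I K where e: "p = (I, K)" by (metis surj_pair)
      have "I \<inter> K = {}" using p disj by (auto simp: e)
      then have "elems T - (I \<union> K) = elems T - I - K" "I \<union> K - I = K" by auto
      then show "(case p of (I, K) \<Rightarrow>
            ?x (piece T (elems T - I - K)) * ?y (piece T K) * ?z (piece T I)) =
          ((\<lambda>(J, I). ?x (piece T (elems T - J)) * (?y (piece T (J - I)) * ?z (piece T I)))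
            \<circ> (\<lambda>(I, K). (I \<union> K, I))) p"
        by (simp add: e mult.assoc)
    qed
  qed
  also have "\<dots> = (\<Sum>(J, I)\<in>?B. ?x (piece T (elems T - J)) * (?y (piece T (J - I)) * ?z (piece T I)))"
    by (simp only: ideals_nested[OF T(1)])
  also have "\<dots> = (\<Sum>J\<in>ideals T. \<Sum>I\<in>ideals (subposet T J).
      ?x (piece T (elems T - J)) * (?y (piece T (J - I)) * ?z (piece T I)))"
    using fin sub by (intro sum.Sigma[symmetric] finite_ideals T(1)) auto
  also have "\<dots> = Poly_Mapping.lookup (h_star x (h_star y z)) t"
    unfolding T(2) lookup_h_star[OF T(1)]
  proof (intro sum.cong refl)
    fix J assume "J \<in> ideals T"
    note J = sub[OF this]
    have "Poly_Mapping.lookup (h_star y z) (piece T J) =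
      (\<Sum>I\<in>ideals (subposet T J). ?y (piece T (J - I)) * ?z (piece T I))"
      unfolding piece_def[of T J] lookup_h_star[OF W[OF J]]
      by (intro sum.cong refl) (simp add: sub2)
    then show "(\<Sum>I\<in>ideals (subposet T J).
        ?x (piece T (elems T - J)) * (?y (piece T (J - I)) * ?z (piece T I))) =
      ?x (piece T (elems T - J)) * Poly_Mapping.lookup (h_star y z) (piece T J)"
      by (simp add: sum_distrib_left)
  qed
  finally show "Poly_Mapping.lookup (h_star (h_star x y) z) t =
    Poly_Mapping.lookup (h_star x (h_star y z)) t" .
qed

lemma piece_eq_empty_iff:
  assumes "WN T" "S \<subseteq> elems T"
  shows "piece T S = wn_empty \<longleftrightarrow> S = {}"
proof -
  have "finite (elems T)" using WN_double_poset[OF assms(1)] by (simp add: double_poset_def)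
  then have "finite S" using assms(2) by (rule rev_finite_subset)
  then show ?thesis using assms by (simp add: wn_size_piece flip: wn_size_eq_0_iff)
qed

lemma h_star_one:
  fixes x :: "'k::field hwnp"
  shows "h_star h_one x = x" "h_star x h_one = x"
proof (rule_tac [!] poly_mapping_eqI)
  fix t
  obtain T where T: "WN T" "t = abs_wnp T" by (rule wnp_cases)
  have sub: "I \<subseteq> elems T" if "I \<in> ideals T" for I using that by (auto simp: ideals_def ideal_def)
  have mem: "{} \<in> ideals T" "elems T \<in> ideals T" by (auto simp: ideals_def ideal_def)
  have "Poly_Mapping.lookup (h_star h_one x) t = (\<Sum>I\<in>ideals T.
      if I = elems T then Poly_Mapping.lookup x (piece T I) else 0)"
    unfolding T(2) lookup_h_star[OF T(1)] h_one_def lookup_basis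
  proof (intro sum.cong refl)
    fix I assume "I \<in> ideals T"
    then have "elems T - I = {} \<longleftrightarrow> I = elems T" using sub by blast
    then show "(if piece T (elems T - I) = wn_empty then 1 else 0) * Poly_Mapping.lookup x (piece T I)
        = (if I = elems T then Poly_Mapping.lookup x (piece T I) else 0)"
      using piece_eq_empty_iff[OF T(1), of "elems T - I"] by simp
  qed
  then show "Poly_Mapping.lookup (h_star h_one x) t = Poly_Mapping.lookup x t"
    using mem by (simp add: finite_ideals T piece_all)
  have "Poly_Mapping.lookup (h_star x h_one) t = (\<Sum>I\<in>ideals T.
      if I = {} then Poly_Mapping.lookup x (piece T (elems T - I)) else 0)"
    unfolding T(2) lookup_h_star[OF T(1)] h_one_def lookup_basis
    by (intro sum.cong refl) (simp add: piece_eq_empty_iff[OF T(1) sub])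
  then show "Poly_Mapping.lookup (h_star x h_one) t = Poly_Mapping.lookup x t"
    using mem by (simp add: finite_ideals T piece_all)
qed

section \<open>The two 2-As algebras and freeness of the first\<close>

lemma two_as_algebra_leadsto_natural:
  "two_as_algebra (h_scale :: 'k::field \<Rightarrow> 'k hwnp \<Rightarrow> _) h_leadsto h_natural h_one"
  unfolding two_as_algebra_def h_leadsto_def h_natural_def h_one_def
  by (intro conjI unital_assoc_algebra_monoid) (simp_all add: wn_r_sum_assoc wn_h_sum_assoc)

lemma two_as_algebra_star_leadsto:
  "two_as_algebra (h_scale :: 'k::field \<Rightarrow> 'k hwnp \<Rightarrow> _) h_star h_leadsto h_one"
proof -
  have "unital_assoc_algebra (h_scale :: 'k \<Rightarrow> 'k hwnp \<Rightarrow> _) h_star h_one"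
    using h_star_assoc[where 'k = 'k] h_star_one[where 'k = 'k]
    unfolding h_star_def by (rule unital_assoc_algebra_bilinear_ext)
  then show ?thesis
    using two_as_algebra_leadsto_natural[where 'k = 'k] by (simp add: two_as_algebra_def)
qed

lemma two_as_morphism_iff:
  "two_as_morphism s1 d1 a1 e1 s2 d2 a2 e2 f \<longleftrightarrow>
    two_as_algebra s1 d1 a1 e1 \<and> two_as_algebra s2 d2 a2 e2 \<and>
    (\<forall>x y. f (x + y) = f x + f y) \<and> (\<forall>c x. f (s1 c x) = s2 c (f x)) \<and>
    f e1 = e2 \<and> (\<forall>x y. f (d1 x y) = d2 (f x) (f y)) \<and> (\<forall>x y. f (a1 x y) = a2 (f x) (f y))"
  unfolding two_as_morphism_def two_as_morphism_axioms_def Vector_Spaces.linear_iff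
    two_as_algebra_def unital_assoc_algebra_def by blast

lemma two_as_morphism_linear:
  "two_as_morphism s1 d1 a1 e1 s2 d2 a2 e2 f \<Longrightarrow> Vector_Spaces.linear s1 s2 f"
  unfolding two_as_morphism_def by blast

lemma h_leadsto_basis: "h_leadsto (basis a) (basis b) = basis (wn_r_sum a b)"
  and h_natural_basis: "h_natural (basis a) (basis b) = basis (wn_h_sum a b)"
  by (simp_all add: h_leadsto_def h_natural_def bilinear_ext_basis)

text \<open>
  The universal property of the basis, \<open>wnp_universal\<close>, applied to the two multiplications of the
  target and extended linearly.
\<close>

lemma two_as_free_leadsto_natural:
  "two_as_free_on TYPE('b::ab_group_add) (h_scale :: 'k::field \<Rightarrow> _) h_leadsto h_natural h_one h_point"
  unfolding two_as_free_on_def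
proof (intro conjI allI impI two_as_algebra_leadsto_natural)
  fix s :: "'k \<Rightarrow> 'b \<Rightarrow> 'b" and dot ast one y
  assume alg: "two_as_algebra s dot ast one"
  interpret two_as_algebra s dot ast one by fact
  have vs: "vector_space s" by unfold_locales
  obtain F where F: "F wn_empty = one" "F wn_point = y"
    "\<And>a b. F (wn_r_sum a b) = dot (F a) (F b)" "\<And>a b. F (wn_h_sum a b) = ast (F a) (F b)"
    using wnp_universal[of dot ast one y] dot.mult_assoc ast.mult_assoc dot.mult_one_left
      dot.mult_one_right ast.mult_one_left ast.mult_one_right by metis
  let ?f = "lin_ext s F"
  note lin = linear_lin_ext[OF vs, of F]
  note lin' = lin[unfolded Vector_Spaces.linear_iff]
  have f_basis: "?f (basis P) = F P" for P by (rule lin_ext_basis[OF vs])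
  note l = linear_bilinear_ext(1) and r = linear_bilinear_ext(2)
  have mor: "two_as_morphism h_scale h_leadsto h_natural h_one s dot ast one ?f"
    unfolding two_as_morphism_iff
  proof (intro conjI two_as_algebra_leadsto_natural alg)
    show "\<forall>x y. ?f (h_leadsto x y) = dot (?f x) (?f y)"
    proof (intro allI)
      show "?f (h_leadsto x y) = dot (?f x) (?f y)" for x y
      proof (rule bilinear_eq_on_basis[of s "\<lambda>x y. ?f (h_leadsto x y)" "\<lambda>x y. dot (?f x) (?f y)"])
        show "?f (h_leadsto (basis P) (basis Q)) = dot (?f (basis P)) (?f (basis Q))" for P Q
          by (simp add: h_leadsto_basis f_basis F)
      qed (unfold h_leadsto_def, rule linear_compose_hwnp[OF l lin], rule linear_compose_hwnp[OF r lin],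
          use lin' in \<open>auto simp: Vector_Spaces.linear_iff dot.mult_add_left dot.mult_add_right
            dot.mult_scale_left dot.mult_scale_right\<close>)
    qed
    show "\<forall>x y. ?f (h_natural x y) = ast (?f x) (?f y)"
    proof (intro allI)
      show "?f (h_natural x y) = ast (?f x) (?f y)" for x y
      proof (rule bilinear_eq_on_basis[of s "\<lambda>x y. ?f (h_natural x y)" "\<lambda>x y. ast (?f x) (?f y)"])
        show "?f (h_natural (basis P) (basis Q)) = ast (?f (basis P)) (?f (basis Q))" for P Q
          by (simp add: h_natural_basis f_basis F)
      qed (unfold h_natural_def, rule linear_compose_hwnp[OF l lin], rule linear_compose_hwnp[OF r lin],
          use lin' in \<open>auto simp: Vector_Spaces.linear_iff ast.mult_add_left ast.mult_add_right
            ast.mult_scale_left ast.mult_scale_right\<close>)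
    qed
  qed (use lin' in \<open>simp_all add: h_one_def f_basis F\<close>)
  moreover have "?f h_point = y" by (simp add: h_point_def f_basis F)
  moreover have "g = ?f"
    if g: "two_as_morphism h_scale h_leadsto h_natural h_one s dot ast one g" "g h_point = y" for g
  proof
    note h = g(1)[unfolded two_as_morphism_iff]
    have "g (basis P) = F P" for P
    proof (induction P rule: wnp_induct)
      case empty
      then show ?case using h F by (simp add: h_one_def)
    next
      case point
      then show ?case using g(2) F by (simp add: h_point_def)
    next
      case (r_sum a b)
      then show ?case using h F by (simp flip: h_leadsto_basis)
    next
      case (h_sum a b)
      then show ?case using h F by (simp flip: h_natural_basis)
    qed
    then show "g x = ?f x" for x
      using linear_eq_on_basis[OF two_as_morphism_linear[OF g(1)] lin] f_basis by metis
  qed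
  ultimately show "\<exists>!f. two_as_morphism h_scale h_leadsto h_natural h_one s dot ast one f \<and> f h_point = y"
    by blast
qed

section \<open>Leading terms\<close>

text \<open>
  \<open>P\<close> is the leading term of \<open>x\<close>, with coefficient \<open>1\<close>. The condition on sizes is needed for
  \<open>h_star\<close>, where the number of possible relations between two factors depends on their sizes.
\<close>

definition leads :: "'k::field hwnp \<Rightarrow> wnp \<Rightarrow> bool" where
  "leads x P \<longleftrightarrow> Poly_Mapping.lookup x P = 1 \<and>
     (\<forall>R. Poly_Mapping.lookup x R \<noteq> 0 \<longrightarrow>
        wn_size R = wn_size P \<and> (R = P \<or> wn_h_count R < wn_h_count P))"

lemma leads_basis: "leads (basis P) P"
  by (simp add: leads_def lookup_basis)

lemma leads_h_leadsto:
  assumes "leads x P" "leads y Q"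
  shows "leads (h_leadsto x y) (wn_r_sum P Q)"
proof -
  let ?x = "Poly_Mapping.lookup x" and ?y = "Poly_Mapping.lookup y"
  let ?A = "Poly_Mapping.keys x \<times> Poly_Mapping.keys y"
  have x: "?x P = 1" "\<And>R. ?x R \<noteq> 0 \<Longrightarrow> wn_size R = wn_size P \<and> (R = P \<or> wn_h_count R < wn_h_count P)"
    and y: "?y Q = 1" "\<And>R. ?y R \<noteq> 0 \<Longrightarrow> wn_size R = wn_size Q \<and> (R = Q \<or> wn_h_count R < wn_h_count Q)"
    using assms unfolding leads_def by blast+
  have L: "Poly_Mapping.lookup (h_leadsto x y) R =
      (\<Sum>(P', Q')\<in>?A. if R = wn_r_sum P' Q' then ?x P' * ?y Q' else 0)" for R
    unfolding h_leadsto_def lookup_bilinear_ext lookup_basis sum.cartesian_product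
    by (intro sum.cong refl) auto
  have key: "P' = P \<and> Q' = Q \<or> wn_h_count (wn_r_sum P' Q') < wn_h_count (wn_r_sum P Q)"
    and key_size: "wn_size (wn_r_sum P' Q') = wn_size (wn_r_sum P Q)"
    if "(P', Q') \<in> ?A" for P' Q'
    using x(2)[of P'] y(2)[of Q'] that by (auto simp: in_keys_iff)
  have "Poly_Mapping.lookup (h_leadsto x y) (wn_r_sum P Q) = 
     (\<Sum>(P', Q')\<in>{(P, Q)}. if wn_r_sum P Q = wn_r_sum P' Q' then ?x P' * ?y Q' else 0)"
    unfolding L
  proof (rule sum.mono_neutral_right)
    show "{(P, Q)} \<subseteq> ?A" using x(1) y(1) by (simp add: in_keys_iff)
    show "\<forall>p\<in>?A - {(P, Q)}. (case p of (P', Q') \<Rightarrow>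
        if wn_r_sum P Q = wn_r_sum P' Q' then ?x P' * ?y Q' else 0) = 0"
    proof
      fix p assume p: "p \<in> ?A - {(P, Q)}"
      obtain P' Q' where e: "p = (P', Q')" by (cases p)
      have "wn_h_count (wn_r_sum P' Q') < wn_h_count (wn_r_sum P Q)"
        using key[of P' Q'] p unfolding e by blast
      then have "wn_r_sum P Q \<noteq> wn_r_sum P' Q'" by (metis less_irrefl)
      then show "(case p of (P', Q') \<Rightarrow>
          if wn_r_sum P Q = wn_r_sum P' Q' then ?x P' * ?y Q' else 0) = 0"
        by (simp add: e)
    qed
  qed simp
  also have "\<dots> = 1" using x(1) y(1) by simp
  finally have 1: "Poly_Mapping.lookup (h_leadsto x y) (wn_r_sum P Q) = 1" .
  have "wn_size R = wn_size (wn_r_sum P Q) \<and>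
      (R = wn_r_sum P Q \<or> wn_h_count R < wn_h_count (wn_r_sum P Q))"
    if R: "Poly_Mapping.lookup (h_leadsto x y) R \<noteq> 0" for R
  proof -
    have "\<exists>p\<in>?A. (case p of (P', Q') \<Rightarrow> if R = wn_r_sum P' Q' then ?x P' * ?y Q' else 0) \<noteq> 0"
      using R unfolding L by (meson sum.neutral)
    then obtain P' Q' where "(P', Q') \<in> ?A" "R = wn_r_sum P' Q'" by (auto split: if_splits)
    then show ?thesis using key[of P' Q'] key_size[of P' Q'] by metis
  qed
  with 1 show ?thesis by (simp add: leads_def)
qed

text \<open>
  The relations of \<open>T\<close> are those inside the two pieces and those from the complement of the ideal to
  the ideal; none lead out of the ideal. The bound is reached if all pairs of the last kind are
  related.
\<close>

lemma h_count_ideal_le: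
  assumes "WN T" "I \<in> ideals T"
  shows "card (le_h T) \<le> wn_h_count (piece T (elems T - I)) + wn_h_count (piece T I)
      + card (elems T - I) * card I"
    and "card (le_h T) = wn_h_count (piece T (elems T - I)) + wn_h_count (piece T I)
      + card (elems T - I) * card I \<Longrightarrow> h_cut T (elems T - I)"
proof -
  let ?J = "elems T - I"
  have I: "I \<subseteq> elems T" "\<And>x y. x \<in> I \<Longrightarrow> y \<in> elems T \<Longrightarrow> (x, y) \<in> le_h T \<Longrightarrow> y \<in> I"
    using assms(2) by (auto simp: ideals_def ideal_def)
  have field: "(x, y) \<in> le_h T \<Longrightarrow> x \<in> elems T \<and> y \<in> elems T" for x y
    using double_poset_field(1)[OF WN_double_poset[OF assms(1)]] .
  have fin: "finite (elems T)" using WN_double_poset[OF assms(1)] by (simp add: double_poset_def)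
  then have finI: "finite I" using I(1) by (rule rev_finite_subset)
  have finh: "finite (le_h T)" by (rule finite_le_h[OF assms(1)])
  have "le_h T = (le_h T \<inter> ?J \<times> ?J) \<union> (le_h T \<inter> I \<times> I) \<union> (le_h T \<inter> ?J \<times> I)"
    (is "_ = ?a \<union> ?b \<union> ?c")
  proof
    show "le_h T \<subseteq> ?a \<union> ?b \<union> ?c"
    proof
      fix p assume p: "p \<in> le_h T"
      obtain x y where xy: "p = (x, y)" by (cases p)
      then show "p \<in> ?a \<union> ?b \<union> ?c" using p field[of x y] I(2)[of x y] by blast
    qed
  qed blast
  then have "card (le_h T) = card (?a \<union> ?b \<union> ?c)" by simp
  also have "\<dots> = card (?a \<union> ?b) + card ?c" by (rule card_Un_disjoint) (use finh in auto)
  also have "card (?a \<union> ?b) = card ?a + card ?b" by (rule card_Un_disjoint) (use finh in auto)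
  also have "card ?a = wn_h_count (piece T ?J)"
    using wn_h_count_abs[OF WN_subposet[OF assms(1) Diff_subset]] by (simp add: piece_def)
  also have "card ?b = wn_h_count (piece T I)"
    using wn_h_count_abs[OF WN_subposet[OF assms(1) I(1)]] by (simp add: piece_def)
  finally have sum: "card (le_h T) = wn_h_count (piece T ?J) + wn_h_count (piece T I) + card ?c" .
  have "finite (?J \<times> I)" using fin finI by simp
  then have le: "card ?c \<le> card (?J \<times> I)" by (rule card_mono) blast
  then show "card (le_h T) \<le> wn_h_count (piece T ?J) + wn_h_count (piece T I) + card ?J * card I"
    using sum by (simp add: card_cartesian_product)
  assume "card (le_h T) = wn_h_count (piece T ?J) + wn_h_count (piece T I) + card ?J * card I"
  then have "card ?c = card (?J \<times> I)" using sum by (simp add: card_cartesian_product)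
  with \<open>finite (?J \<times> I)\<close> have "?c = ?J \<times> I" by (intro card_subset_eq) auto
  then have "?J \<times> I \<subseteq> le_h T" by blast
  then show "h_cut T ?J" by (auto simp: h_cut_def)
qed

text \<open>
  By \<open>h_count_ideal_le\<close>, a term of \<open>h_star x y\<close> with as many relations as \<open>wn_h_sum P Q\<close> comes from an
  ideal of type \<open>Q\<close> whose complement is an \<open>h\<close>-cut of type \<open>P\<close>, and so is \<open>wn_h_sum P Q\<close> itself.
  Cuts of the same cardinality coincide, so there is just one such ideal and the coefficient is \<open>1\<close>.
\<close>

lemma leads_h_star:
  assumes "leads x P" "leads y Q"
  shows "leads (h_star x y) (wn_h_sum P Q)"
proof -
  let ?x = "Poly_Mapping.lookup x" and ?y = "Poly_Mapping.lookup y"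
  have x: "?x P = 1" "\<And>R. ?x R \<noteq> 0 \<Longrightarrow> wn_size R = wn_size P \<and> (R = P \<or> wn_h_count R < wn_h_count P)"
    and y: "?y Q = 1" "\<And>R. ?y R \<noteq> 0 \<Longrightarrow> wn_size R = wn_size Q \<and> (R = Q \<or> wn_h_count R < wn_h_count Q)"
    using assms unfolding leads_def by blast+
  have key: "wn_size (abs_wnp T) = wn_size P + wn_size Q \<and>
      (h_cut T (elems T - I) \<and> piece T (elems T - I) = P \<and> piece T I = Q
        \<or> wn_h_count (abs_wnp T) < wn_h_count (wn_h_sum P Q))"
    if T: "WN T" and I: "I \<in> ideals T"
      and nz: "?x (piece T (elems T - I)) \<noteq> 0" "?y (piece T I) \<noteq> 0" for T I
  proof -
    have sub: "I \<subseteq> elems T" using I by (auto simp: ideals_def ideal_def)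
    have fin: "finite (elems T)" using WN_double_poset[OF T] by (simp add: double_poset_def)
    have sz: "card (elems T - I) = wn_size P" "card I = wn_size Q"
      using x(2)[OF nz(1)] y(2)[OF nz(2)] sub T by (simp_all add: wn_size_piece)
    have "card (elems T) = card (elems T - I) + card I"
      using fin sub by (metis card_Diff_subset card_mono finite_subset le_add_diff_inverse2)
    then have size: "wn_size (abs_wnp T) = wn_size P + wn_size Q" using sz T by (simp add: wn_size_abs)
    note le = h_count_ideal_le[OF T I, unfolded sz, folded wn_h_count_abs[OF T]]
    have xle: "piece T (elems T - I) = P \<or> wn_h_count (piece T (elems T - I)) < wn_h_count P"
      and yle: "piece T I = Q \<or> wn_h_count (piece T I) < wn_h_count Q"
      using x(2)[OF nz(1)] y(2)[OF nz(2)] by blast+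
    show ?thesis
    proof (cases "wn_h_count (abs_wnp T) < wn_h_count (wn_h_sum P Q)")
      case False
      then have "wn_h_count P + wn_h_count Q + wn_size P * wn_size Q \<le> wn_h_count (abs_wnp T)" by simp
      then have "piece T (elems T - I) = P" "piece T I = Q"
        using le(1) xle yle by fastforce+
      moreover from this have "h_cut T (elems T - I)"
        using le False by simp
      ultimately show ?thesis using size by blast
    qed (use size in blast)
  qed
  have "wn_size R = wn_size (wn_h_sum P Q) \<and>
      (R = wn_h_sum P Q \<or> wn_h_count R < wn_h_count (wn_h_sum P Q))"
    if R: "Poly_Mapping.lookup (h_star x y) R \<noteq> 0" for R
  proof -
    obtain T where T: "WN T" "R = abs_wnp T" by (rule wnp_cases)
    have "\<exists>I\<in>ideals T. ?x (piece T (elems T - I)) * ?y (piece T I) \<noteq> 0"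
      using R unfolding T(2) lookup_h_star[OF T(1)] by (meson sum.neutral)
    then obtain I where I: "I \<in> ideals T" "?x (piece T (elems T - I)) \<noteq> 0" "?y (piece T I) \<noteq> 0"
      by auto
    have sub: "I \<subseteq> elems T" using I(1) by (auto simp: ideals_def ideal_def)
    have "R = wn_h_sum P Q" if "h_cut T (elems T - I)" "piece T (elems T - I) = P" "piece T I = Q"
      using h_sum_of_h_cut[OF T(1) that(1)] that(2,3) sub T(2) by (simp add: double_diff)
    with key[OF T(1) I] show ?thesis unfolding T(2) by auto
  qed
  moreover have "Poly_Mapping.lookup (h_star x y) (wn_h_sum P Q) = 1"
  proof -
    obtain T where T: "WN T" "wn_h_sum P Q = abs_wnp T" by (rule wnp_cases)
    have pl: "plane_poset T" using T(1) by (simp add: WN_def)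
    obtain S where S: "h_cut T S" "piece T S = P" "piece T (elems T - S) = Q"
      using h_cut_of_h_sum[OF T(1) T(2)[symmetric]] by metis
    have sub: "S \<subseteq> elems T" using S(1) by (rule h_cut_sub)
    have I0: "elems T - S \<in> ideals T"
      unfolding ideals_def ideal_def
    proof (intro CollectI conjI ballI impI Diff_subset)
      fix a b assume ab: "a \<in> elems T - S" "b \<in> elems T" "(a, b) \<in> le_h T"
      show "b \<in> elems T - S"
      proof (rule ccontr)
        assume "b \<notin> elems T - S"
        then have "b \<in> S" using ab by blast
        then have "(b, a) \<in> le_h T" using S(1) ab by (auto simp: h_cut_def)
        then have "a = b" using plane_poset_rules(3)[OF pl] ab by blast
        then show False using \<open>b \<in> S\<close> ab by blast
      qed
    qed
    have "Poly_Mapping.lookup (h_star x y) (wn_h_sum P Q) =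
        (\<Sum>I\<in>{elems T - S}. ?x (piece T (elems T - I)) * ?y (piece T I))"
      unfolding T(2) lookup_h_star[OF T(1)]
    proof (rule sum.mono_neutral_right[OF finite_ideals[OF T(1)]])
      show "{elems T - S} \<subseteq> ideals T" using I0 by simp
      show "\<forall>I\<in>ideals T - {elems T - S}. ?x (piece T (elems T - I)) * ?y (piece T I) = 0"
      proof (rule ballI, rule ccontr)
        fix I assume I: "I \<in> ideals T - {elems T - S}"
          and "?x (piece T (elems T - I)) * ?y (piece T I) \<noteq> 0"
        then have cut: "h_cut T (elems T - I)" "piece T (elems T - I) = P"
          using key[of T I] T by auto
        have "card (elems T - I) = card S"
          using cut S(2) T(1) sub by (metis Diff_subset wn_size_piece)
        then have "elems T - I = S"
          using h_cut_subset[OF pl cut(1) S(1)] h_cut_subset[OF pl S(1) cut(1)] by simp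
        moreover have "I \<subseteq> elems T" using I by (auto simp: ideals_def ideal_def)
        ultimately show False using I by blast
      qed
    qed
    also have "\<dots> = 1" using S sub x(1) y(1) by (simp add: double_diff)
    finally show ?thesis .
  qed
  ultimately show ?thesis by (simp add: leads_def)
qed

lemma leads_morphism:
  assumes "two_as_morphism (h_scale :: 'k::field \<Rightarrow> _) h_leadsto h_natural h_one
      h_scale h_star h_leadsto h_one \<phi>" "\<phi> h_point = h_point"
  shows "leads (\<phi> (basis P)) (wn_swap P)"
proof (induction P rule: wnp_induct)
  note h = assms(1)[unfolded two_as_morphism_iff]
  case empty
  have "\<phi> (basis wn_empty) = basis wn_empty" using h by (simp add: h_one_def)
  then show ?case by (simp add: leads_basis)
next
  case point
  have "\<phi> (basis wn_point) = basis wn_point" using assms(2) by (simp add: h_point_def)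
  then show ?case by (simp add: leads_basis)
next
  note h = assms(1)[unfolded two_as_morphism_iff]
  case (r_sum a b)
  have "\<phi> (basis (wn_r_sum a b)) = h_star (\<phi> (basis a)) (\<phi> (basis b))"
    using h by (simp flip: h_leadsto_basis)
  then show ?case using leads_h_star r_sum by (simp add: wn_swap_r_sum)
next
  note h = assms(1)[unfolded two_as_morphism_iff]
  case (h_sum a b)
  have "\<phi> (basis (wn_h_sum a b)) = h_leadsto (\<phi> (basis a)) (\<phi> (basis b))"
    using h by (simp flip: h_natural_basis)
  then show ?case using leads_h_leadsto h_sum by (simp add: wn_swap_h_sum)
qed

text \<open>
  Unitriangular maps are bijective. If \<open>f z = 0\<close> with \<open>z \<noteq> 0\<close>, take \<open>P\<close> in the support of \<open>z\<close> for which
  \<open>s P\<close> has the most relations: nothing else contributes to the coefficient of \<open>s P\<close> in \<open>f z\<close>. For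
  surjectivity, each basis element differs from an image by smaller basis elements.
\<close>

lemma bij_if_leads:
  fixes f :: "'k::field hwnp \<Rightarrow> 'k hwnp"
  assumes lin: "Vector_Spaces.linear h_scale h_scale f"
    and leads: "\<And>P. leads (f (basis P)) (s P)" and s: "bij s"
  shows "bij f"
proof -
  interpret Vector_Spaces.linear h_scale h_scale f by (rule lin)
  have inj_s: "s P = s Q \<longleftrightarrow> P = Q" for P Q using s by (metis bij_def injD)
  have "inj f"
  proof (rule injI, rule ccontr)
    fix x y assume "f x = f y" "x \<noteq> y"
    define z where "z = x - y"
    have z: "z \<noteq> 0" "f z = 0" using \<open>f x = f y\<close> \<open>x \<noteq> y\<close> by (simp_all add: z_def diff)
    then have K: "Poly_Mapping.keys z \<noteq> {}" "finite (Poly_Mapping.keys z)" by simp_all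
    define M where "M = Max ((\<lambda>P. wn_h_count (s P)) ` Poly_Mapping.keys z)"
    have "M \<in> (\<lambda>P. wn_h_count (s P)) ` Poly_Mapping.keys z" unfolding M_def using K by simp
    then obtain P where P: "P \<in> Poly_Mapping.keys z" "wn_h_count (s P) = M" by auto
    have max: "wn_h_count (s Q) \<le> wn_h_count (s P)" if "Q \<in> Poly_Mapping.keys z" for Q
      unfolding P(2) M_def using K(2) that by simp
    have "0 = Poly_Mapping.lookup (f z) (s P)" using z by simp
    also have "\<dots> = (\<Sum>Q\<in>Poly_Mapping.keys z.
        Poly_Mapping.lookup z Q * Poly_Mapping.lookup (f (basis Q)) (s P))"
      by (subst linear_expand[OF lin]) (simp add: lookup_sum)
    also have "\<dots> = (\<Sum>Q\<in>{P}. Poly_Mapping.lookup z Q * Poly_Mapping.lookup (f (basis Q)) (s P))"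
    proof (rule sum.mono_neutral_right)
      show "\<forall>Q\<in>Poly_Mapping.keys z - {P}.
          Poly_Mapping.lookup z Q * Poly_Mapping.lookup (f (basis Q)) (s P) = 0"
      proof
        fix Q assume Q: "Q \<in> Poly_Mapping.keys z - {P}"
        then have "s P \<noteq> s Q" "\<not> wn_h_count (s P) < wn_h_count (s Q)"
          using max[of Q] by (auto simp: inj_s)
        then show "Poly_Mapping.lookup z Q * Poly_Mapping.lookup (f (basis Q)) (s P) = 0"
          using leads[of Q] by (auto simp: leads_def)
      qed
    qed (use K P in auto)
    also have "\<dots> = Poly_Mapping.lookup z P" using leads[of P] by (simp add: leads_def)
    finally show False using P(1) by (simp add: in_keys_iff)
  qed
  moreover have "surj f"
  proof -
    have basis: "basis R \<in> range f" for R
    proof (induction "wn_h_count R" arbitrary: R rule: less_induct)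
      case less
      obtain P where P: "s P = R" using s by (metis bij_pointE)
      let ?v = "f (basis P)" let ?K = "Poly_Mapping.keys ?v - {R}"
      have lead: "Poly_Mapping.lookup ?v R = 1" "\<And>Q. Q \<in> ?K \<Longrightarrow> wn_h_count Q < wn_h_count R"
        using leads[of P] by (auto simp: leads_def P in_keys_iff)
      have "\<exists>u. \<forall>Q\<in>?K. basis Q = f (u Q)"
        using less.hyps lead(2) by (intro bchoice) blast
      then obtain u where u: "\<And>Q. Q \<in> ?K \<Longrightarrow> basis Q = f (u Q)" by blast
      have "R \<in> Poly_Mapping.keys ?v" using lead(1) by (simp add: in_keys_iff)
      have "?v = (\<Sum>Q\<in>Poly_Mapping.keys ?v. h_scale (Poly_Mapping.lookup ?v Q) (basis Q))"
        by (rule hwnp_expand)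
      also have "\<dots> = h_scale (Poly_Mapping.lookup ?v R) (basis R)
          + (\<Sum>Q\<in>?K. h_scale (Poly_Mapping.lookup ?v Q) (basis Q))"
        using \<open>R \<in> Poly_Mapping.keys ?v\<close> by (intro sum.remove) simp_all
      also have "(\<Sum>Q\<in>?K. h_scale (Poly_Mapping.lookup ?v Q) (basis Q)) =
          f (\<Sum>Q\<in>?K. h_scale (Poly_Mapping.lookup ?v Q) (u Q))"
        unfolding sum scale
      proof (intro sum.cong refl)
        fix Q assume "Q \<in> ?K"
        then show "h_scale (Poly_Mapping.lookup ?v Q) (basis Q)
            = h_scale (Poly_Mapping.lookup ?v Q) (f (u Q))"
          by (subst u[symmetric]) simp_all
      qed
      finally have "?v = basis R + f (\<Sum>Q\<in>?K. h_scale (Poly_Mapping.lookup ?v Q) (u Q))"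
        by (simp only: lead(1) vs1.scale_one)
      then have "f (basis P - (\<Sum>Q\<in>?K. h_scale (Poly_Mapping.lookup ?v Q) (u Q))) = basis R"
        unfolding diff by (metis add_diff_cancel_right')
      then show ?case by (metis rangeI)
    qed
    have "\<exists>u. \<forall>R. basis R = f (u R)" by (rule choice) (use basis in blast)
    then obtain u where u: "\<And>R. basis R = f (u R)" by blast
    have "f (\<Sum>R\<in>Poly_Mapping.keys x. h_scale (Poly_Mapping.lookup x R) (u R)) = x" for x
      using hwnp_expand[of x] by (simp add: sum scale flip: u)
    then show ?thesis by (rule surjI[where g = f])
  qed
  ultimately show ?thesis by (rule bijI)
qed

section \<open>Transport of freeness along an isomorphism\<close>

lemma two_as_morphism_compose:
  assumes "two_as_morphism s1 d1 a1 e1 s2 d2 a2 e2 f" "two_as_morphism s2 d2 a2 e2 s3 d3 a3 e3 g"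
  shows "two_as_morphism s1 d1 a1 e1 s3 d3 a3 e3 (g \<circ> f)"
  using assms unfolding two_as_morphism_iff by simp

lemma two_as_morphism_inv:
  assumes "two_as_morphism s1 d1 a1 e1 s2 d2 a2 e2 f" "bij f"
  shows "two_as_morphism s2 d2 a2 e2 s1 d1 a1 e1 (inv f)"
proof -
  have inv: "f (inv f x) = x" "inv f (f y) = y" for x y
    using assms(2) by (simp_all add: bij_is_surj bij_is_inj surj_f_inv_f)
  note h = assms(1)[unfolded two_as_morphism_iff]
  have eq: "inv f a = b" if "a = f b" for a b using that inv by simp
  show ?thesis
    unfolding two_as_morphism_iff using h by (auto intro!: eq simp: inv)
qed

lemma two_as_free_transport:
  fixes s1 :: "'k::field \<Rightarrow> 'a::ab_group_add \<Rightarrow> 'a" and s2 :: "'k \<Rightarrow> 'c::ab_group_add \<Rightarrow> 'c"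
  assumes free: "two_as_free_on TYPE('b::ab_group_add) s1 d1 a1 e1 x1"
    and f: "two_as_morphism s1 d1 a1 e1 s2 d2 a2 e2 f" "bij f" "f x1 = x2"
  shows "two_as_free_on TYPE('b) s2 d2 a2 e2 x2"
  unfolding two_as_free_on_def
proof (intro conjI allI impI)
  show "two_as_algebra s2 d2 a2 e2" using f(1) unfolding two_as_morphism_iff by blast
  fix s :: "'k \<Rightarrow> 'b \<Rightarrow> 'b" and dot ast one y
  assume alg: "two_as_algebra s dot ast one"
  have ex: "\<exists>!g. two_as_morphism s1 d1 a1 e1 s dot ast one g \<and> g x1 = y"
    using free alg unfolding two_as_free_on_def by blast
  then obtain g where g: "two_as_morphism s1 d1 a1 e1 s dot ast one g" "g x1 = y" by blast
  have inv: "inv f x2 = x1" using f(2,3) by (auto simp: bij_is_inj)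
  show "\<exists>!h. two_as_morphism s2 d2 a2 e2 s dot ast one h \<and> h x2 = y"
  proof (rule ex1I[of _ "g \<circ> inv f"])
    show "two_as_morphism s2 d2 a2 e2 s dot ast one (g \<circ> inv f) \<and> (g \<circ> inv f) x2 = y"
      using two_as_morphism_compose[OF two_as_morphism_inv[OF f(1,2)] g(1)] g(2) inv by simp
    fix h assume h: "two_as_morphism s2 d2 a2 e2 s dot ast one h \<and> h x2 = y"
    then have "two_as_morphism s1 d1 a1 e1 s dot ast one (h \<circ> f)" "(h \<circ> f) x1 = y"
      using two_as_morphism_compose[OF f(1)] f(3) by auto
    then have "h \<circ> f = g" using ex g by blast
    moreover have "f \<circ> inv f = id" by (metis f(2) bij_is_surj surj_iff)
    ultimately show "h = g \<circ> inv f" by (metis comp_assoc comp_id)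
  qed
qed

theorem corollary38:
  shows "(\<exists>!\<phi> :: 'k::field hwnp \<Rightarrow> 'k hwnp.
            two_as_morphism h_scale h_leadsto h_natural h_one h_scale h_star h_leadsto h_one \<phi>
            \<and> \<phi> h_point = h_point)
       \<and> (\<forall>\<phi> :: 'k hwnp \<Rightarrow> 'k hwnp.
            two_as_morphism h_scale h_leadsto h_natural h_one h_scale h_star h_leadsto h_one \<phi>
            \<and> \<phi> h_point = h_point \<longrightarrow> bij \<phi>)
       \<and> two_as_free_on TYPE('b::ab_group_add) (h_scale :: 'k \<Rightarrow> _) h_star h_leadsto h_one h_point"
proof -
  have ex: "\<exists>!\<phi> :: 'k hwnp \<Rightarrow> 'k hwnp.
      two_as_morphism h_scale h_leadsto h_natural h_one h_scale h_star h_leadsto h_one \<phi>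
      \<and> \<phi> h_point = h_point"
    using two_as_free_leadsto_natural[where 'k = 'k and 'b = "'k hwnp"] two_as_algebra_star_leadsto
    unfolding two_as_free_on_def by blast
  have bij: "bij \<phi>"
    if "two_as_morphism h_scale h_leadsto h_natural h_one h_scale h_star h_leadsto h_one \<phi>
      \<and> \<phi> h_point = h_point" for \<phi> :: "'k hwnp \<Rightarrow> 'k hwnp"
  proof (rule bij_if_leads[where s = wn_swap])
    show "leads (\<phi> (basis P)) (wn_swap P)" for P using leads_morphism that by blast
    show "bij wn_swap" by (rule involuntory_imp_bij) simp
    show "Vector_Spaces.linear h_scale h_scale \<phi>" using that two_as_morphism_linear by blast
  qed
  obtain \<phi> :: "'k hwnp \<Rightarrow> 'k hwnp" where \<phi>:
    "two_as_morphism h_scale h_leadsto h_natural h_one h_scale h_star h_leadsto h_one \<phi>"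
    "\<phi> h_point = h_point"
    using ex by blast
  have "two_as_free_on TYPE('b) (h_scale :: 'k \<Rightarrow> _) h_star h_leadsto h_one h_point"
    using two_as_free_transport[OF two_as_free_leadsto_natural \<phi>(1) _ \<phi>(2)] bij \<phi> by blast
  with ex bij show ?thesis by blast
qed

end
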